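(* For every $d\geq 2$, there is a constant $\gamma=\gamma(d)>0$ such that for every $\varepsilon\in(0,1)$, there is a set $S\subseteq\mathbb{R}^d$ satisfying $\operatorname{c}(S)\leq\varepsilon$ and $\operatorname{b}_d(S)\geq\gamma\,\dfrac{\varepsilon}{\log_2 (1/\varepsilon)}$, and in particular, we have $\operatorname{b}_d(S)\geq\gamma\,\dfrac{\operatorname{c}(S)}{\log_2 (1/\operatorname{c}(S))}$.
   Context: Here $d$ is an integer, $\lambda_k$ denotes $k$-dimensional Lebesgue measure, "measurable" means Lebesgue measurable, and $\operatorname{Conv}$ denotes the convex hull. For $k\in\{1,\dots,d\}$ and $S\subseteq\mathbb{R}^d$, let $\operatorname{Simp}_k(S)=\{(A_0,\dots,A_k)\in S^{k+1}:\operatorname{Conv}(\{A_0,\dots,A_k\})\subseteq S\}\subseteq(\mathbb{R}^d)^{k+1}$. The $k$-index of convexity of $S$ is $\operatorname{b}_k(S)=\lambda_{(k+1)d}(\operatorname{Simp}_k(S))/\lambda_d(S)^{k+1}$; it is defined if and only if $S$ is measurable with finite positive measure and $\operatorname{Simp}_k(S)$ is measurable. The convexity ratio of a set $S\subseteq\mathbb{R}^d$ of finite positive measure is $\operatorname{c}(S)=\operatorname{smc}(S)/\lambda_d(S)$, where $\operatorname{smc}(S)$ is the supremum of the measures $\lambda_d$ of convex subsets of $S$.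
   Formalization: As printed the claim fails as ε→1, since b_d(S) ≤ 1 while ε/log₂(1/ε) → ∞; proved instead: for every ε₀ < 1 there is γ = γ(d, ε₀) > 0 that works for all ε in (0, ε₀] (ε₀ = 1/2 gives γ depending only on d). *)

theory Defs
  imports "HOL-Analysis.Analysis"
begin

text \<open>
  Lebesgue measure on the space of \<open>(k+1)\<close>-tuples of points of \<open>\<real>\<^sup>d\<close>, where \<open>d = CARD('n)\<close>.  A tuple
  \<open>(A\<^sub>0, \<dots>, A\<^sub>k)\<close> is an extensional function on \<open>{..k}\<close>.  The completion makes the measurable sets
  the Lebesgue measurable ones, and not just the Borel ones.
\<close>

definition tuple_lebesgue :: "nat \<Rightarrow> (nat \<Rightarrow> real ^ 'n) measure" where
  "tuple_lebesgue k = completion (\<Pi>\<^sub>M i\<in>{..k}. lborel)"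

definition Simp :: "nat \<Rightarrow> (real ^ 'n) set \<Rightarrow> (nat \<Rightarrow> real ^ 'n) set" where
  "Simp k S = {A \<in> {..k} \<rightarrow>\<^sub>E S. convex hull (A ` {..k}) \<subseteq> S}"

definition convexity_index_defined :: "nat \<Rightarrow> (real ^ 'n) set \<Rightarrow> bool" where
  "convexity_index_defined k S \<longleftrightarrow>
     S \<in> lmeasurable \<and> measure lebesgue S > 0 \<and> Simp k S \<in> sets (tuple_lebesgue k)"

text \<open>
  This is meaningful only under \<^const>\<open>convexity_index_defined\<close>.  Its value is then at most 1,
  because \<open>Simp k S\<close> is contained in \<open>S\<^bsup>k+1\<^esup>\<close>.  Hence a lower bound \<open>\<gamma> * (\<epsilon> / log 2 (1 / \<epsilon>))\<close>,
  which tends to infinity as \<open>\<epsilon>\<close> tends to 1, can hold with a constant \<open>\<gamma> > 0\<close> only as long as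
  \<open>\<epsilon>\<close> stays away from 1.
\<close>

definition convexity_index :: "nat \<Rightarrow> (real ^ 'n) set \<Rightarrow> real" where
  "convexity_index k S = measure (tuple_lebesgue k) (Simp k S) / measure lebesgue S ^ (k + 1)"

text \<open>
  Convex sets are Lebesgue measurable, so no measurability condition is put on \<open>K\<close>.  If \<open>S\<close> has
  finite measure, the measures form a nonempty set of reals that is bounded above, so the real
  supremum is the intended one.
\<close>

definition smc :: "(real ^ 'n) set \<Rightarrow> real" where
  "smc S = (SUP K\<in>{K. convex K \<and> K \<subseteq> S}. measure lebesgue K)"

definition convexity_ratio :: "(real ^ 'n) set \<Rightarrow> real" where
  "convexity_ratio S = smc S / measure lebesgue S"

end

theory Submission
  imports Defs
begin

text \<open>
  The set \<open>S\<close> is the unit cube with a finite set \<open>N\<close> removed, whose size is at most of order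
  \<open>(1 / \<epsilon>) * log 2 (1 / \<epsilon>)\<close>.
  Two facts carry the proof.

  First, \<open>N\<close> can be chosen to meet every convex subset of the cube of volume more than \<open>\<epsilon>\<close>
  (\<open>convex_net_exists\<close>), so that the convexity ratio of \<open>S\<close> is at most \<open>\<epsilon>\<close>.  Every such convex set
  contains a parallelepiped whose volume is a constant fraction of its own, and up to a perturbation
  there are only polynomially many parallelepipeds in terms of \<open>1 / \<epsilon>\<close>.  Points chosen greedily hit all of them after
  a number of steps of order \<open>1 / \<epsilon>\<close> times the logarithm of their number.

  Secondly, whatever set \<open>N\<close> of at most \<open>n \<ge> 4\<close> points is removed, a random simplex avoids \<open>N\<close> with
  probability at least \<open>c / n\<close> (\<open>avoiding_measure_ge\<close>).  With probability of order \<open>1 / n\<close> the last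
  vertex is so close to the hyperplane through the others that the simplex lies in a slab of thickness
  less than \<open>1 / (4 * n)\<close> in a fixed direction (\<open>thin_tuples_measure_ge\<close>).  The translates of such a simplex
  by \<open>2 * n\<close> consecutive multiples of \<open>1 / (4 * n)\<close> in that direction are pairwise disjoint, so at least half of
  them avoid \<open>N\<close> (\<open>half_of_translates_avoid\<close>).  Both probabilities are estimated by translation
  invariance and counting alone, without integrating over coordinates one after the other.

  Together the index of \<open>S\<close> is at least a constant times \<open>1 / n\<close>, where \<open>n\<close> is of order
  \<open>(1 / \<epsilon>) * log 2 (1 / \<epsilon>)\<close>.  The bound in terms of the convexity ratio follows because
  \<open>x / log 2 (1 / x)\<close> is increasing.
\<close>

section \<open>The unit cube\<close>

definition unit_cube :: "(real ^ 'n) set" where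
  "unit_cube = cbox 0 (\<chi> i. 1)"

lemma mem_unit_cube: "x \<in> unit_cube \<longleftrightarrow> (\<forall>i. 0 \<le> x $ i \<and> x $ i \<le> 1)"
  by (simp add: unit_cube_def mem_box_cart)

lemma unit_cube_borel [simp]: "unit_cube \<in> sets borel"
  by (simp add: unit_cube_def)

lemma convex_unit_cube [simp]: "convex unit_cube"
  by (simp add: unit_cube_def)

lemma lmeasurable_unit_cube [simp]: "unit_cube \<in> lmeasurable"
  by (simp add: unit_cube_def)

lemma measure_unit_cube [simp]: "measure lebesgue (unit_cube :: (real ^ 'n) set) = 1"
proof -
  have "cbox 0 (\<chi> i. 1) \<noteq> ({} :: (real ^ 'n) set)" by (simp add: interval_ne_empty_cart)
  then show ?thesis
    by (simp add: unit_cube_def content_cbox_cart)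
qed

section \<open>Tuples of points and their translations\<close>
text \<open>
  Products of copies of \<open>lborel\<close> carry the translation invariance and the box formula.  All sets that
  matter below are already measurable before completion, so the completed measure of the tuple space
  enters only at the very end.
\<close>
abbreviation tuples :: "nat \<Rightarrow> (nat \<Rightarrow> real ^ 'n) measure" where
  "tuples k \<equiv> (\<Pi>\<^sub>M i\<in>{..k}. lborel)"

definition shift_tuple :: "nat \<Rightarrow> (nat \<Rightarrow> real ^ 'n) \<Rightarrow> (nat \<Rightarrow> real ^ 'n) \<Rightarrow> nat \<Rightarrow> real ^ 'n" where
  "shift_tuple k v A = (\<lambda>i\<in>{..k}. A i + v i)"

lemma space_tuples: "space (tuples k) = {..k} \<rightarrow>\<^sub>E UNIV"
  by (simp add: space_PiM)

lemma product_sigma_finite_lborel: "product_sigma_finite (\<lambda>i::nat. lborel :: (real ^ 'n) measure)"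
  by (simp add: product_sigma_finite_def lborel.sigma_finite_measure_axioms)

lemma measurable_tuple_component [measurable]:
  "i \<le> k \<Longrightarrow> (\<lambda>A. A i) \<in> borel_measurable (tuples k :: (nat \<Rightarrow> real ^ 'n) measure)"
  using measurable_component_singleton[of i "{..k}" "\<lambda>_. lborel :: (real ^ 'n) measure"] by simp

lemma measurable_shift_tuple [measurable]:
  "shift_tuple k v \<in> measurable (tuples k) (tuples k :: (nat \<Rightarrow> real ^ 'n) measure)"
  unfolding shift_tuple_def
  by (rule measurable_restrict) (use measurable_tuple_component in auto)

lemma emeasure_lborel_translate_vimage:
  fixes v :: "'a::euclidean_space"
  assumes "X \<in> sets borel"
  shows "emeasure lborel {x. x + v \<in> X} = emeasure lborel X"
proof -
  have "emeasure lborel X = emeasure (distr lborel borel ((+) v)) X"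
    by (simp add: lborel_distr_plus)
  also have "\<dots> = emeasure lborel ((+) v -` X \<inter> space lborel)"
    by (rule emeasure_distr) (use assms in auto)
  also have "(+) v -` X \<inter> space lborel = {x. x + v \<in> X}"
    by (auto simp: add.commute)
  finally show ?thesis by simp
qed

text \<open>
  Each factor of the product is translation invariant, and a measure on the product is determined by
  its values on boxes.
\<close>
lemma distr_shift_tuple:
  fixes v :: "nat \<Rightarrow> real ^ 'n"
  shows "distr (tuples k) (tuples k) (shift_tuple k v) = tuples k"
proof -
  interpret product_sigma_finite "\<lambda>i::nat. lborel :: (real ^ 'n) measure"
    by (rule product_sigma_finite_lborel)
  show ?thesis
  proof (rule PiM_eqI)
    fix X :: "nat \<Rightarrow> (real ^ 'n) set"
    assume X: "\<And>i. i \<in> {..k} \<Longrightarrow> X i \<in> sets lborel"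
    have "emeasure (distr (tuples k) (tuples k) (shift_tuple k v)) (Pi\<^sub>E {..k} X)
        = emeasure (tuples k) (shift_tuple k v -` Pi\<^sub>E {..k} X \<inter> space (tuples k))"
      by (intro emeasure_distr measurable_shift_tuple sets_PiM_I_finite) (use X in auto)
    also have "shift_tuple k v -` Pi\<^sub>E {..k} X \<inter> space (tuples k)
        = Pi\<^sub>E {..k} (\<lambda>i. {x. x + v i \<in> X i})"
      by (auto simp: shift_tuple_def space_tuples PiE_iff)
    also have "emeasure (tuples k) \<dots> = (\<Prod>i\<in>{..k}. emeasure lborel {x. x + v i \<in> X i})"
    proof (rule emeasure_PiM)
      fix i assume "i \<in> {..k}"
      then have "(\<lambda>x. x + v i) -` X i \<inter> space borel \<in> sets borel"
        by (intro measurable_sets[of _ borel borel]) (use X in auto)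
      then show "{x. x + v i \<in> X i} \<in> sets lborel"
        by (simp add: vimage_def)
    qed simp
    also have "\<dots> = (\<Prod>i\<in>{..k}. emeasure lborel (X i))"
      by (intro prod.cong emeasure_lborel_translate_vimage) (use X in auto)
    finally show "emeasure (distr (tuples k) (tuples k) (shift_tuple k v)) (Pi\<^sub>E {..k} X)
        = (\<Prod>i\<in>{..k}. emeasure lborel (X i))" .
  qed auto
qed

lemma emeasure_shift_tuple_vimage:
  fixes X :: "(nat \<Rightarrow> real ^ 'n) set"
  assumes "X \<in> sets (tuples k)"
  shows "emeasure (tuples k) {A \<in> space (tuples k). shift_tuple k v A \<in> X} = emeasure (tuples k) X"
proof -
  have "emeasure (tuples k) X = emeasure (distr (tuples k) (tuples k) (shift_tuple k v)) X"
    by (simp add: distr_shift_tuple)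
  also have "\<dots> = emeasure (tuples k) (shift_tuple k v -` X \<inter> space (tuples k))"
    by (rule emeasure_distr) (use assms measurable_shift_tuple in auto)
  also have "shift_tuple k v -` X \<inter> space (tuples k) = {A \<in> space (tuples k). shift_tuple k v A \<in> X}"
    by auto
  finally show ?thesis by simp
qed

section \<open>Simplices that miss a finite set\<close>
text \<open>
  Strict inequalities that are continuous in \<open>w\<close> hold on an open set of \<open>w\<close>, so \<open>w\<close> may be restricted to a
  countable dense set.  This is what makes conditions such as ``some hyperplane separates'' measurable.
\<close>
lemma sets_exists_strict_positive:
  fixes f :: "'w::second_countable_topology \<Rightarrow> 'a \<Rightarrow> 'j \<Rightarrow> real"
  assumes "finite J"
    and meas: "\<And>w j. j \<in> J \<Longrightarrow> (\<lambda>x. f w x j) \<in> borel_measurable M"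
    and cont: "\<And>x j. continuous_on UNIV (\<lambda>w. f w x j)"
  shows "{x \<in> space M. \<exists>w. \<forall>j\<in>J. 0 < f w x j} \<in> sets M"
proof -
  obtain D :: "'w set" where D: "countable D" "\<And>X. open X \<Longrightarrow> X \<noteq> {} \<Longrightarrow> \<exists>w\<in>D. w \<in> X"
    by (rule countable_dense_setE) blast
  have "\<exists>w\<in>D. \<forall>j\<in>J. 0 < f w x j" if "\<exists>w. \<forall>j\<in>J. 0 < f w x j" for x
  proof -
    have "open (\<Inter>j\<in>J. {w. 0 < f w x j})"
      using \<open>finite J\<close> cont by (intro open_INT ballI open_Collect_less) auto
    from D(2)[OF this] that show ?thesis by auto
  qed
  then have "{x \<in> space M. \<exists>w. \<forall>j\<in>J. 0 < f w x j} = (\<Union>w\<in>D. {x \<in> space M. \<forall>j\<in>J. 0 < f w x j})"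
    by blast
  also have "\<dots> \<in> sets M"
  proof (rule sets.countable_UN''[OF D(1)])
    fix w
    show "{x \<in> space M. \<forall>j\<in>J. 0 < f w x j} \<in> sets M"
    proof (cases "J = {}")
      case False
      show ?thesis
      proof (rule sets.sets_Collect_finite_All'[OF _ \<open>finite J\<close> False])
        fix j assume "j \<in> J"
        from meas[OF this, of w] show "{x \<in> space M. 0 < f w x j} \<in> sets M"
          by measurable
      qed
    qed simp
  qed
  finally show ?thesis .
qed

text \<open>
  Strict separation of a point from a finite set turns membership in a convex hull into the kind of
  condition that \<open>sets_exists_strict_positive\<close> covers.
\<close>
lemma not_in_hull_iff_half_space:
  fixes X :: "'a::euclidean_space set"
  assumes "finite X" "X \<noteq> {}"
  shows "p \<notin> convex hull X \<longleftrightarrow> (\<exists>w. \<forall>x\<in>X. 0 < w \<bullet> (x - p))"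
proof
  assume p: "p \<notin> convex hull X"
  have "closed (convex hull X)"
    using assms(1) by (simp add: compact_imp_closed finite_imp_compact_convex_hull)
  then obtain w b where "w \<bullet> p < b" "\<forall>x\<in>convex hull X. w \<bullet> x > b"
    using separating_hyperplane_closed_point[of "convex hull X" p] p by auto
  moreover have "X \<subseteq> convex hull X" by (rule hull_subset)
  ultimately have "\<forall>x\<in>X. 0 < w \<bullet> (x - p)"
    by (fastforce simp: inner_diff_right)
  then show "\<exists>w. \<forall>x\<in>X. 0 < w \<bullet> (x - p)" ..
next
  assume "\<exists>w. \<forall>x\<in>X. 0 < w \<bullet> (x - p)"
  then obtain w where w: "\<And>x. x \<in> X \<Longrightarrow> w \<bullet> p < w \<bullet> x"
    by (auto simp: inner_diff_right)
  have "convex hull X \<subseteq> {x. w \<bullet> p < w \<bullet> x}"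
    using w convex_halfspace_gt[of "w \<bullet> p" w] by (intro hull_minimal) auto
  then show "p \<notin> convex hull X" by auto
qed

definition avoiding :: "nat \<Rightarrow> (real ^ 'n) set \<Rightarrow> (real ^ 'n) set \<Rightarrow> (nat \<Rightarrow> real ^ 'n) set" where
  "avoiding k C N = {A \<in> {..k} \<rightarrow>\<^sub>E C. convex hull (A ` {..k}) \<inter> N = {}}"

text \<open>
  In a convex set with holes, only the holes can stop a simplex from lying in the set; vertices in a
  hole are excluded automatically because vertices belong to the hull.
\<close>
lemma Simp_Diff_eq_avoiding:
  assumes "convex C"
  shows "Simp k (C - N) = avoiding k C N"
proof -
  have "convex hull (A ` {..k}) \<subseteq> C" if "A \<in> {..k} \<rightarrow>\<^sub>E C" for A
    using that assms by (intro hull_minimal) auto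
  moreover have "A ` {..k} \<subseteq> convex hull (A ` {..k})" for A :: "nat \<Rightarrow> real ^ 'a"
    by (rule hull_subset)
  ultimately show ?thesis
    unfolding Simp_def avoiding_def
    by (intro Collect_cong iffI conjI) (simp_all add: PiE_iff, blast+)
qed

lemma sets_avoiding:
  assumes "finite N" "C \<in> sets borel"
  shows "avoiding k C N \<in> sets (tuples k)"
proof -
  have "{A \<in> space (tuples k). \<exists>w. \<forall>i\<in>{..k}. 0 < w \<bullet> (A i - p)} \<in> sets (tuples k)" for p :: "real ^ 'a"
  proof (rule sets_exists_strict_positive)
    fix w :: "real ^ 'a" and i assume "i \<in> {..k}"
    then have "(\<lambda>A. A i) \<in> borel_measurable (tuples k :: (nat \<Rightarrow> real ^ 'a) measure)"
      by (intro measurable_tuple_component) auto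
    then show "(\<lambda>A. w \<bullet> (A i - p)) \<in> borel_measurable (tuples k)"
      by measurable
  qed (auto intro!: continuous_intros)
  then have "{A \<in> space (tuples k). p \<notin> convex hull (A ` {..k})} \<in> sets (tuples k)" for p :: "real ^ 'a"
    by (subst not_in_hull_iff_half_space) auto
  then have "(\<Inter>p\<in>N. {A \<in> space (tuples k). p \<notin> convex hull (A ` {..k})}) \<inter> ({..k} \<rightarrow>\<^sub>E C) \<in> sets (tuples k)"
    if "N \<noteq> {}"
    using assms that by (intro sets.Int sets.finite_INT sets_PiM_I_finite) auto
  moreover have "avoiding k C N = (if N = {} then {..k} \<rightarrow>\<^sub>E C else 
     (\<Inter>p\<in>N. {A \<in> space (tuples k). p \<notin> convex hull (A ` {..k})}) \<inter> ({..k} \<rightarrow>\<^sub>E C))"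
    by (auto simp: avoiding_def space_tuples PiE_iff extensional_def)
  ultimately show ?thesis
    using assms by (auto intro!: sets_PiM_I_finite)
qed

section \<open>Half of the translates of a thin simplex survive\<close>
text \<open>
  For \<open>w \<bullet> e > 0\<close>, which the case \<open>i = j\<close> forces when \<open>s > 0\<close>, the condition says that the points
  lie in a slab between two hyperplanes orthogonal to \<open>w\<close> whose distance measured in direction \<open>e\<close> is
  less than \<open>s\<close>.  Not normalising \<open>w\<close> keeps the condition open in \<open>w\<close>, and hence measurable.
\<close>
definition thin :: "nat \<Rightarrow> real ^ 'n \<Rightarrow> real \<Rightarrow> (nat \<Rightarrow> real ^ 'n) \<Rightarrow> bool" where
  "thin k e s A \<longleftrightarrow> (\<exists>w. \<forall>i\<in>{..k}. \<forall>j\<in>{..k}. w \<bullet> (A i - A j) < s * (w \<bullet> e))"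

lemma sets_thin:
  fixes C :: "(real ^ 'n) set"
  assumes "C \<in> sets borel"
  shows "{A \<in> {..k} \<rightarrow>\<^sub>E C. thin k e s A} \<in> sets (tuples k)"
proof -
  have "{A \<in> space (tuples k). \<exists>w. \<forall>ij\<in>{..k} \<times> {..k}. 0 < s * (w \<bullet> e) - w \<bullet> (A (fst ij) - A (snd ij))} \<in> sets (tuples k)"
  proof (rule sets_exists_strict_positive)
    fix w :: "real ^ 'n" and ij assume "ij \<in> {..k} \<times> {..k}"
    then have "(\<lambda>A. A (fst ij)) \<in> borel_measurable (tuples k :: (nat \<Rightarrow> real ^ 'n) measure)"
      "(\<lambda>A. A (snd ij)) \<in> borel_measurable (tuples k :: (nat \<Rightarrow> real ^ 'n) measure)"
      by (auto intro!: measurable_tuple_component)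
    then show "(\<lambda>A. s * (w \<bullet> e) - w \<bullet> (A (fst ij) - A (snd ij))) \<in> borel_measurable (tuples k)"
      by measurable
  qed (auto intro!: continuous_intros)
  then have "{A \<in> space (tuples k). \<exists>w. \<forall>ij\<in>{..k} \<times> {..k}. 0 < s * (w \<bullet> e) - w \<bullet> (A (fst ij) - A (snd ij))} \<inter> ({..k} \<rightarrow>\<^sub>E C) \<in> sets (tuples k)"
    using assms by (intro sets.Int sets_PiM_I_finite) auto
  also have "{A \<in> space (tuples k). \<exists>w. \<forall>ij\<in>{..k} \<times> {..k}. 0 < s * (w \<bullet> e) - w \<bullet> (A (fst ij) - A (snd ij))} \<inter> ({..k} \<rightarrow>\<^sub>E C)
     = {A \<in> {..k} \<rightarrow>\<^sub>E C. thin k e s A}"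
    by (auto simp: thin_def space_tuples PiE_iff extensional_def)
  finally show ?thesis .
qed

lemma hull_diff_less:
  assumes w: "\<forall>i\<in>{..k}. \<forall>j\<in>{..k}. w \<bullet> (A i - A j) < c"
    and x: "x \<in> convex hull (A ` {..k})" and y: "y \<in> convex hull (A ` {..k})"
  shows "w \<bullet> (x - y) < c"
proof -
  have *: "w \<bullet> z < c + w \<bullet> A j" if "z \<in> convex hull (A ` {..k})" "j \<le> k" for z j
  proof -
    have "convex hull (A ` {..k}) \<subseteq> {z. w \<bullet> z < c + w \<bullet> A j}"
      using w that(2) by (intro hull_minimal) (auto simp: convex_halfspace_lt inner_diff_right algebra_simps)
    with that(1) show ?thesis by auto
  qed
  have "convex hull (A ` {..k}) \<subseteq> {z. w \<bullet> z > w \<bullet> x - c}"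
    using *[OF x] by (intro hull_minimal convex_halfspace_gt) (auto simp: algebra_simps)
  with y show ?thesis by (auto simp: inner_diff_right)
qed

text \<open>
  Translating a slab of thickness less than \<open>s\<close> by a nonzero multiple of \<open>s\<close> moves it off itself.
\<close>
lemma thin_translates_disjoint:
  fixes A :: "nat \<Rightarrow> real ^ 'n"
  assumes "thin k e s A" and "s > 0"
    and i: "p - (real i * s) *\<^sub>R e \<in> convex hull (A ` {..k})"
    and j: "p - (real j * s) *\<^sub>R e \<in> convex hull (A ` {..k})"
  shows "i = j"
proof -
  obtain w where w: "\<forall>i\<in>{..k}. \<forall>j\<in>{..k}. w \<bullet> (A i - A j) < s * (w \<bullet> e)"
    using assms(1) by (auto simp: thin_def)
  from w have "0 < s * (w \<bullet> e)" by force
  then have pos: "w \<bullet> e > 0" using \<open>s > 0\<close> by (simp add: zero_less_mult_iff)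
  have "(real j - real i) * (s * (w \<bullet> e)) < 1 * (s * (w \<bullet> e))"
    using hull_diff_less[OF w i j] by (simp add: inner_diff_right algebra_simps)
  moreover have "(real i - real j) * (s * (w \<bullet> e)) < 1 * (s * (w \<bullet> e))"
    using hull_diff_less[OF w j i] by (simp add: inner_diff_right algebra_simps)
  ultimately have "real j - real i < 1" "real i - real j < 1"
    using \<open>0 < s * (w \<bullet> e)\<close> mult_less_cancel_right_pos by blast+
  then show ?thesis by linarith
qed

lemma hull_shift_tuple:
  "convex hull (shift_tuple k (\<lambda>_. v) A ` {..k}) = (\<lambda>x. v + x) ` (convex hull (A ` {..k}))"
proof -
  have "shift_tuple k (\<lambda>_. v) A ` {..k} = (\<lambda>x. v + x) ` (A ` {..k})"
    by (auto simp: shift_tuple_def image_image add.commute)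
  then show ?thesis by (simp add: convex_hull_translation)
qed

text \<open>
  The \<open>2 * n\<close> translates of the hull are pairwise disjoint, so each of the at most \<open>n\<close> points
  of \<open>N\<close> spoils at most one of them.
\<close>
lemma half_of_translates_avoid:
  fixes A :: "nat \<Rightarrow> real ^ 'n"
  assumes "thin k e s A" "s > 0" "finite N" "card N \<le> n"
  shows "n \<le> card {j \<in> {..<2*n}. convex hull (shift_tuple k (\<lambda>_. (real j * s) *\<^sub>R e) A ` {..k}) \<inter> N = {}}"
    (is "n \<le> card {j \<in> {..<2*n}. ?H j \<inter> N = {}}")
proof -
  define bad where "bad = {j \<in> {..<2*n}. ?H j \<inter> N \<noteq> {}}"
  have "\<exists>q. \<forall>j\<in>bad. q j \<in> ?H j \<inter> N"
    by (rule bchoice) (auto simp: bad_def)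
  then obtain q where q: "\<And>j. j \<in> bad \<Longrightarrow> q j \<in> ?H j \<inter> N" by blast
  have "inj_on q bad"
  proof (rule inj_onI)
    fix i j assume ij: "i \<in> bad" "j \<in> bad" "q i = q j"
    have "q i - (real i * s) *\<^sub>R e \<in> convex hull (A ` {..k})"
      using q[OF ij(1)] by (auto simp: hull_shift_tuple)
    moreover have "q i - (real j * s) *\<^sub>R e \<in> convex hull (A ` {..k})"
      using q[OF ij(2)] ij(3) by (auto simp: hull_shift_tuple)
    ultimately show "i = j"
      using thin_translates_disjoint assms(1,2) by blast
  qed
  moreover have "q ` bad \<subseteq> N" using q by auto
  ultimately have "card bad \<le> n"
    using assms(3,4) by (meson card_inj_on_le order_trans)
  moreover have "{j \<in> {..<2*n}. ?H j \<inter> N = {}} = {..<2*n} - bad"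
    by (auto simp: bad_def)
  moreover have "card ({..<2*n} - bad) = 2 * n - card bad"
    by (subst card_Diff_subset) (auto simp: bad_def)
  ultimately show ?thesis by simp
qed

text \<open>
  The good translates of thin tuples are counted in two ways.  For a fixed tuple at least \<open>n\<close> of the
  \<open>2 * n\<close> shifts lead to a tuple whose hull avoids \<open>N\<close>.  For a fixed shift, translation invariance bounds
  the measure of the tuples that it makes avoiding by the measure of all avoiding tuples.
\<close>
lemma thin_le_twice_avoiding:
  fixes e :: "real ^ 'n" and C L :: "(real ^ 'n) set"
  assumes "finite N" "card N \<le> n" "n > 0" "s > 0"
    and C: "C \<in> sets borel" and L: "L \<in> sets borel"
    and shift: "\<And>x j. x \<in> L \<Longrightarrow> j < 2 * n \<Longrightarrow> x + (real j * s) *\<^sub>R e \<in> C"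
  shows "emeasure (tuples k) {A \<in> {..k} \<rightarrow>\<^sub>E L. thin k e s A} \<le> 2 * emeasure (tuples k) (avoiding k C N)"
    (is "emeasure ?M ?T \<le> 2 * emeasure ?M ?G")
proof -
  define sh where "sh = (\<lambda>j. shift_tuple k (\<lambda>_. (real j * s) *\<^sub>R e))"
  have G: "?G \<in> sets ?M" by (rule sets_avoiding[OF \<open>finite N\<close> C])
  have T: "?T \<in> sets ?M" by (rule sets_thin[OF L])
  define P where "P = (\<lambda>j. {A \<in> space ?M. sh j A \<in> ?G})"
  have P: "P j \<in> sets ?M" for j
  proof -
    have "sh j -` ?G \<inter> space ?M \<in> sets ?M"
      unfolding sh_def by (rule measurable_sets[OF measurable_shift_tuple G])
    also have "sh j -` ?G \<inter> space ?M = P j" by (auto simp: P_def)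
    finally show ?thesis .
  qed
  have "of_nat n * emeasure ?M ?T = (\<integral>\<^sup>+A. of_nat n * indicator ?T A \<partial>?M)"
    using T by (simp add: nn_integral_cmult)
  also have "\<dots> \<le> (\<integral>\<^sup>+A. (\<Sum>j<2*n. indicator (P j) A) \<partial>?M)"
  proof (rule nn_integral_mono)
    fix A assume "A \<in> space ?M"
    show "of_nat n * indicator ?T A \<le> (\<Sum>j<2*n. indicator (P j) A :: ennreal)"
    proof (cases "A \<in> ?T")
      case True
      have "{j \<in> {..<2*n}. convex hull (sh j A ` {..k}) \<inter> N = {}} \<subseteq> {j \<in> {..<2*n}. A \<in> P j}"
        using True shift \<open>A \<in> space ?M\<close>
        by (auto simp: P_def avoiding_def sh_def shift_tuple_def PiE_iff)
      then have "card {j \<in> {..<2*n}. convex hull (sh j A ` {..k}) \<inter> N = {}} \<le> card {j \<in> {..<2*n}. A \<in> P j}"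
        by (intro card_mono) auto
      moreover have "n \<le> card {j \<in> {..<2*n}. convex hull (sh j A ` {..k}) \<inter> N = {}}"
        unfolding sh_def using True assms by (intro half_of_translates_avoid) auto
      ultimately have "n \<le> card {j \<in> {..<2*n}. A \<in> P j}" by simp
      then have "of_nat n \<le> (of_nat (card {j \<in> {..<2*n}. A \<in> P j}) :: ennreal)"
        by (rule of_nat_mono)
      also have "\<dots> = (\<Sum>j<2*n. indicator (P j) A)"
        by (simp add: indicator_def sum.If_cases Int_def)
      finally show ?thesis using True by simp
    qed simp
  qed
  also have "\<dots> = (\<Sum>j<2*n. emeasure ?M (P j))"
    using P by (simp add: nn_integral_sum)
  also have "\<dots> = (\<Sum>j<2*n. emeasure ?M ?G)"
    unfolding P_def sh_def using emeasure_shift_tuple_vimage[OF G] by simp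
  also have "\<dots> = of_nat n * (2 * emeasure ?M ?G)"
    by (simp add: mult_ac)
  finally show ?thesis
    using \<open>n > 0\<close> by (subst (asm) ennreal_mult_le_mult_iff) auto
qed

section \<open>There are many thin simplices\<close>
text \<open>
  The first \<open>d\<close> points lie close to a corner and the ends of the edges in all coordinate directions
  except \<open>h 0\<close>, so the hyperplane through them is the graph of a function of bounded slope over the
  coordinates other than \<open>h 0\<close>.  A nonzero normal vector exists by counting dimensions.  The points are
  so close to the ideal position that the coordinate \<open>h 0\<close> of the normal dominates, as in a diagonally
  dominant system.
\<close>
lemma steep_normal_exists:
  fixes A :: "nat \<Rightarrow> real ^ 'n" and h :: "nat \<Rightarrow> 'n"
  assumes h: "bij_betw h {..<CARD('n)} UNIV"
    and r: "r > 0"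
    and A: "\<And>i x. 0 < i \<Longrightarrow> i < CARD('n) \<Longrightarrow>
              \<bar>A i $ x - A 0 $ x - (if x = h i then r else 0)\<bar> \<le> r / (2 * real CARD('n))"
  obtains w where "w $ h 0 = 1" "(\<Sum>x\<in>UNIV. \<bar>w $ x\<bar>) \<le> 2"
    "\<And>i. i < CARD('n) \<Longrightarrow> w \<bullet> (A i - A 0) = 0"
proof -
  let ?d = "CARD('n)"
  define V where "V = (\<lambda>i. A i - A 0) ` {0<..<?d}"
  have "dim V \<le> card V" by (rule dim_le_card') (simp add: V_def)
  also have "\<dots> \<le> card {0<..<?d}" unfolding V_def by (rule card_image_le) simp
  also have "\<dots> < DIM(real ^ 'n)" by simp
  finally obtain u where u: "u \<noteq> 0" "\<And>y. y \<in> span V \<Longrightarrow> orthogonal u y"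
    by (rule orthogonal_to_subspace_exists) (rule that)
  have u0: "u \<bullet> (A i - A 0) = 0" if "i < ?d" for i
  proof (cases "i = 0")
    case False
    then have "A i - A 0 \<in> span V" using that by (auto simp: V_def intro: span_base)
    then show ?thesis using u(2) by (simp add: orthogonal_def)
  qed simp
  define W where "W = (\<Sum>x\<in>UNIV. \<bar>u $ x\<bar>)"
  have "W \<ge> 0" by (simp add: W_def sum_nonneg)
  \<comment> \<open>Orthogonality to the i-th edge, which is r times a unit vector up to a small error,
    makes the corresponding coordinate of the normal small against the whole vector.\<close>
  have coord: "r * \<bar>u $ h i\<bar> \<le> r / (2 * real ?d) * W" if i: "0 < i" "i < ?d" for i
  proof -
    have "u \<bullet> (A i - A 0) = (\<Sum>x\<in>UNIV. u $ x * ((A i $ x - A 0 $ x - (if x = h i then r else 0)) + (if x = h i then r else 0)))"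
      by (simp add: inner_vec_def)
    also have "\<dots> = (\<Sum>x\<in>UNIV. u $ x * (A i $ x - A 0 $ x - (if x = h i then r else 0))) + (\<Sum>x\<in>UNIV. if x = h i then u $ x * r else 0)"
      by (subst sum.distrib[symmetric]) (rule sum.cong, auto simp: algebra_simps)
    also have "(\<Sum>x\<in>UNIV. if x = h i then u $ x * r else 0) = u $ h i * r"
      by simp
    finally have "(\<Sum>x\<in>UNIV. u $ x * (A i $ x - A 0 $ x - (if x = h i then r else 0))) = - (u $ h i * r)"
      using u0[OF i(2)] by linarith
    then have "r * \<bar>u $ h i\<bar> = \<bar>\<Sum>x\<in>UNIV. u $ x * (A i $ x - A 0 $ x - (if x = h i then r else 0))\<bar>"
      using r by (simp add: abs_mult)
    also have "\<dots> \<le> (\<Sum>x\<in>UNIV. \<bar>u $ x\<bar> * (r / (2 * real ?d)))"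
    proof (rule order_trans[OF sum_abs sum_mono])
      fix x
      show "\<bar>u $ x * (A i $ x - A 0 $ x - (if x = h i then r else 0))\<bar> \<le> \<bar>u $ x\<bar> * (r / (2 * real ?d))"
        unfolding abs_mult by (rule mult_left_mono[OF A[OF i]]) simp
    qed
    also have "\<dots> = r / (2 * real ?d) * W"
      unfolding W_def sum_distrib_left by (simp only: mult.commute)
    finally show ?thesis .
  qed
  have h0: "inj_on h {..<?d}" "h ` {..<?d} = UNIV" using h by (auto simp: bij_betw_def)
  have "W = (\<Sum>i<?d. \<bar>u $ h i\<bar>)"
    unfolding W_def using sum.reindex_bij_betw[OF h, of "\<lambda>x. \<bar>u $ x\<bar>"] by simp
  also have "{..<?d} = insert 0 {0<..<?d}" by (auto simp: Suc_lessI)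
  also have "(\<Sum>i\<in>\<dots>. \<bar>u $ h i\<bar>) = \<bar>u $ h 0\<bar> + (\<Sum>i\<in>{0<..<?d}. \<bar>u $ h i\<bar>)" by simp
  also have "(\<Sum>i\<in>{0<..<?d}. \<bar>u $ h i\<bar>) \<le> (\<Sum>i\<in>{0<..<?d}. W / (2 * real ?d))"
  proof (rule sum_mono)
    fix i assume "i \<in> {0<..<?d}"
    then have "r * \<bar>u $ h i\<bar> \<le> r * (W / (2 * real ?d))" using coord[of i] by simp
    then show "\<bar>u $ h i\<bar> \<le> W / (2 * real ?d)" using r mult_le_cancel_left_pos by blast
  qed
  also have "\<dots> \<le> real ?d * (W / (2 * real ?d))"
    unfolding sum_constant using \<open>W \<ge> 0\<close> by (intro mult_right_mono) auto
  also have "\<dots> = W / 2" by simp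
  finally have W2: "W \<le> 2 * \<bar>u $ h 0\<bar>" by simp
  have "u $ h 0 \<noteq> 0"
  proof
    assume "u $ h 0 = 0"
    then have "W = 0" using W2 \<open>W \<ge> 0\<close> by simp
    then have "\<forall>x. u $ x = 0" by (simp add: W_def sum_nonneg_eq_0_iff)
    with u(1) show False by (simp add: vec_eq_iff)
  qed
  show thesis
  proof (rule that[of "(1 / u $ h 0) *\<^sub>R u"])
    have "(\<Sum>x\<in>UNIV. \<bar>((1 / u $ h 0) *\<^sub>R u) $ x\<bar>) = W / \<bar>u $ h 0\<bar>"
      by (simp add: W_def abs_mult sum_divide_distrib)
    also have "\<dots> \<le> 2" using W2 \<open>u $ h 0 \<noteq> 0\<close> by (simp add: field_simps)
    finally show "(\<Sum>x\<in>UNIV. \<bar>((1 / u $ h 0) *\<^sub>R u) $ x\<bar>) \<le> 2" .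
  qed (use u0 \<open>u $ h 0 \<noteq> 0\<close> in auto)
qed

text \<open>
  Take boxes around the ideal positions of the first \<open>d\<close> vertices and a box for the last one.  For every
  tuple from these boxes, the last vertex can be brought to height less than \<open>s\<close> over the hyperplane through
  the others by moving it along the axis \<open>x0\<close> by an integer multiple of \<open>s = 1 / (4 * n)\<close>, and only \<open>2 * n + 1\<close>
  multiples are needed.  Hence the product of the boxes is covered by \<open>2 * n + 1\<close> translates of the set of
  thin tuples, whose measure is therefore at least of order \<open>1 / n\<close>.
  
  The vertices are kept in the lower half of the cube because thin simplices are later shifted
  upwards by up to \<open>2 * n - 1\<close> times \<open>s\<close>, which is less than \<open>1 / 2\<close>.
\<close>
lemma thin_tuples_measure_ge:
  obtains c :: real and x0 :: "'n::finite" where "c > 0"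
    "\<And>n. n \<ge> 4 \<Longrightarrow> ennreal (c / real n) \<le>
       emeasure (tuples CARD('n)) {A \<in> {..CARD('n)} \<rightarrow>\<^sub>E {x \<in> unit_cube. x $ x0 \<le> 1 / 2}.
         thin CARD('n) (axis x0 1) (1 / (4 * real n)) A}"
proof -
  let ?d = "CARD('n)"
  interpret product_sigma_finite "\<lambda>i::nat. lborel :: (real ^ 'n) measure"
    by (rule product_sigma_finite_lborel)
  obtain h :: "nat \<Rightarrow> 'n" where h: "bij_betw h {..<?d} UNIV"
    using ex_bij_betw_nat_finite[of "UNIV :: 'n set"] by (auto simp: atLeast0LessThan)
  \<comment> \<open>The side length of the boxes is the tolerance in the previous lemma for edges of length 1/8.\<close>
  define \<eta> where "\<eta> = 1 / (16 * real ?d)"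
  have d: "0 < ?d" by simp
  have \<eta>: "0 < \<eta>" "\<eta> \<le> 1 / 16"
    using d unfolding \<eta>_def by (auto simp: field_simps)
  define a :: "nat \<Rightarrow> 'n \<Rightarrow> real" where
    "a = (\<lambda>i x. 1 / 4 + (if 0 < i \<and> i < ?d \<and> x = h i then 1 / 8 else 0))"
  define U :: "nat \<Rightarrow> (real ^ 'n) set" where "U = (\<lambda>i. cbox (\<chi> x. a i x) (\<chi> x. a i x + \<eta>))"
  have "emeasure lborel (U i) = ennreal (\<eta> ^ ?d)" for i
  proof -
    have "cbox (\<chi> x. a i x) (\<chi> x. a i x + \<eta>) \<noteq> ({} :: (real ^ 'n) set)"
      using \<eta> by (simp add: interval_ne_empty_cart)
    then show ?thesis
      by (simp add: U_def emeasure_eq_measure2 content_cbox_cart)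
  qed
  then have "emeasure (tuples ?d) (Pi\<^sub>E {..?d} U) = (\<Prod>i\<in>{..?d}. ennreal (\<eta> ^ ?d))"
    by (subst emeasure_PiM) (auto simp: U_def)
  also have "\<dots> = ennreal ((\<eta> ^ ?d) ^ Suc ?d)"
    using \<eta> by (simp add: ennreal_power ennreal_mult)
  finally have U: "emeasure (tuples ?d) (Pi\<^sub>E {..?d} U) = ennreal ((\<eta> ^ ?d) ^ Suc ?d)" .
  define u where "u = (\<eta> ^ ?d) ^ Suc ?d"
  have "u > 0" using \<eta> by (simp add: u_def)
  show thesis
  proof (rule that[of "u / 3" "h 0"])
    show "u / 3 > 0" using \<open>u > 0\<close> by simp
    fix n :: nat assume n: "n \<ge> 4"
    define s where "s = 1 / (4 * real n)"
    have s: "0 < s" "s \<le> 1 / 16" using n by (auto simp: s_def field_simps)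
    define e :: "real ^ 'n" where "e = axis (h 0) 1"
    define L where "L = {x :: real ^ 'n. x \<in> unit_cube \<and> x $ h 0 \<le> 1 / 2}"
    define T where "T = {A \<in> {..?d} \<rightarrow>\<^sub>E L. thin ?d e s A}"
    have "L = unit_cube \<inter> {x. x $ h 0 \<le> 1 / 2}" by (auto simp: L_def)
    also have "\<dots> \<in> sets borel"
      by (intro sets.Int unit_cube_borel borel_closed closed_Collect_le continuous_intros)
    finally have T: "T \<in> sets (tuples ?d)" unfolding T_def by (rule sets_thin)
    define sh :: "int \<Rightarrow> (nat \<Rightarrow> real ^ 'n) \<Rightarrow> nat \<Rightarrow> real ^ 'n" where
      "sh = (\<lambda>k. shift_tuple ?d (\<lambda>i. if i = ?d then (of_int k * s) *\<^sub>R e else 0))"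
    have cover: "\<exists>k\<in>{-int n..int n}. sh k A \<in> T" if A: "A \<in> Pi\<^sub>E {..?d} U" for A
    proof -
      have coord: "a i x \<le> A i $ x" "A i $ x \<le> a i x + \<eta>" if "i \<le> ?d" for i x
        using PiE_mem[OF A, of i] that by (auto simp: U_def mem_box_cart)
      obtain w where w: "w $ h 0 = 1" "(\<Sum>x\<in>UNIV. \<bar>w $ x\<bar>) \<le> 2"
        "\<And>i. i < ?d \<Longrightarrow> w \<bullet> (A i - A 0) = 0"
      proof (rule steep_normal_exists[OF h, of "1 / 8" A])
        fix i x assume "0 < i" "i < ?d"
        then have "\<bar>A i $ x - A 0 $ x - (if x = h i then 1 / 8 else 0)\<bar> \<le> \<eta>"
          using coord[of i x] coord[of 0 x] by (auto simp: a_def)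
        then show "\<bar>A i $ x - A 0 $ x - (if x = h i then 1 / 8 else 0)\<bar> \<le> 1 / 8 / (2 * real ?d)"
          by (simp add: \<eta>_def)
      qed auto
      \<comment> \<open>The height of the last vertex above the hyperplane, measured along the axis; adding
        a suitable multiple of s brings it into [0, s).\<close>
      define \<beta> where "\<beta> = w \<bullet> (A ?d - A 0)"
      have "\<bar>\<beta>\<bar> \<le> (\<Sum>x\<in>UNIV. \<bar>w $ x\<bar> * \<eta>)"
        unfolding \<beta>_def inner_vec_def
      proof (rule order_trans[OF sum_abs sum_mono])
        fix x :: 'n
        have "\<bar>A ?d $ x - A 0 $ x\<bar> \<le> \<eta>"
          using coord[of ?d x] coord[of 0 x] by (auto simp: a_def)
        then show "\<bar>w $ x \<bullet> (A ?d - A 0) $ x\<bar> \<le> \<bar>w $ x\<bar> * \<eta>"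
          by (simp add: abs_mult mult_left_mono)
      qed
      also have "\<dots> = (\<Sum>x\<in>UNIV. \<bar>w $ x\<bar>) * \<eta>" by (simp add: sum_distrib_right)
      also have "\<dots> \<le> 2 * \<eta>" using w(2) \<eta> by (intro mult_right_mono) auto
      finally have \<beta>: "\<bar>\<beta>\<bar> \<le> 1 / 8" using \<eta> by simp
      define k where "k = \<lceil>- \<beta> / s\<rceil>"
      have "- \<beta> / s \<le> of_int k" "of_int k < - \<beta> / s + 1"
        unfolding k_def by linarith+
      then have ks: "- \<beta> \<le> of_int k * s" "of_int k * s < - \<beta> + s"
        using s by (auto simp: field_simps)
      have "\<bar>of_int k * s\<bar> \<le> 3 / 16" using ks \<beta> s by linarith
      have "of_int k \<le> - \<beta> / s + 1" "- \<beta> / s \<le> of_int k"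
        unfolding k_def by linarith+
      moreover have "\<beta> / s \<le> real n / 2" "- \<beta> / s \<le> real n / 2"
        using mult_right_mono[of \<beta> "1 / 8" "4 * real n"] mult_right_mono[of "- \<beta>" "1 / 8" "4 * real n"] \<beta>
        by (auto simp: s_def)
      ultimately have "\<bar>of_int k\<bar> \<le> real n / 2 + 1"
        unfolding abs_le_iff by linarith
      then have "\<bar>real_of_int k\<bar> \<le> real_of_int (int n)" using n by simp
      then have kn: "k \<in> {-int n..int n}" by simp linarith
      define B where "B = sh k A"
      have B: "B i = A i + (if i = ?d then (of_int k * s) *\<^sub>R e else 0)" if "i \<le> ?d" for i
        using that by (simp add: B_def sh_def shift_tuple_def)
      have "B i \<in> L" if "i \<le> ?d" for i
      proof -
        \<comment> \<open>The last vertex starts at height between 1/4 and 5/16 and moves by at most 3/16.\<close>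
        have a: "a i x \<le> 3 / 8" "1 / 4 \<le> a i x" for x by (auto simp: a_def)
        have *: "1 / 4 \<le> A i $ x" "A i $ x \<le> 7 / 16" for x
          using coord[OF that, of x] a[of x] \<eta> by linarith+
        have **: "A i $ x \<le> 5 / 16" if "i = ?d" for x
          using coord[of i x] that \<eta> by (simp add: a_def)
        have "0 \<le> B i $ x \<and> B i $ x \<le> 1 / 2" for x
          using *[of x] **[of x] \<open>\<bar>of_int k * s\<bar> \<le> 3 / 16\<close> by (auto simp: B[OF that] e_def axis_def)
        then have "0 \<le> B i $ x" "B i $ x \<le> 1 / 2" "B i $ x \<le> 1" for x
          by (auto intro: order_trans[of _ "1/2"])
        then show ?thesis by (simp add: L_def mem_unit_cube)
      qed
      then have "B \<in> {..?d} \<rightarrow>\<^sub>E L"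
        by (auto simp: B_def sh_def shift_tuple_def)
      moreover have "thin ?d e s B"
      proof -
        have we: "w \<bullet> e = 1" using w(1) by (simp add: e_def inner_axis)
        have "w \<bullet> (B i - A 0) \<in> {0..<s}" if "i \<le> ?d" for i
        proof (cases "i = ?d")
          case True
          have "w \<bullet> (B i - A 0) = \<beta> + of_int k * s"
            using True we by (simp add: B \<beta>_def inner_diff_right inner_add_right)
          then show ?thesis using ks by simp
        next
          case False
          then show ?thesis using that w(3)[of i] s by (simp add: B)
        qed
        note B_range = this
        have "w \<bullet> (B i - B j) < s" if "i \<le> ?d" "j \<le> ?d" for i j
          using B_range[OF that(1)] B_range[OF that(2)] by (simp add: inner_diff_right)
        then show ?thesis unfolding thin_def using we by (intro exI[of _ w]) auto
      qed
      ultimately show ?thesis using kn by (auto simp: B_def T_def)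
    qed
    have pre: "{A \<in> space (tuples ?d). sh k A \<in> T} \<in> sets (tuples ?d)" for k
    proof -
      have "sh k -` T \<inter> space (tuples ?d) \<in> sets (tuples ?d)"
        unfolding sh_def by (rule measurable_sets[OF measurable_shift_tuple T])
      also have "sh k -` T \<inter> space (tuples ?d) = {A \<in> space (tuples ?d). sh k A \<in> T}"
        by auto
      finally show ?thesis .
    qed
    have "ennreal u = emeasure (tuples ?d) (Pi\<^sub>E {..?d} U)" using U by (simp add: u_def)
    also have "\<dots> \<le> emeasure (tuples ?d) (\<Union>k\<in>{-int n..int n}. {A \<in> space (tuples ?d). sh k A \<in> T})"
    proof (rule emeasure_mono)
      show "Pi\<^sub>E {..?d} U \<subseteq> (\<Union>k\<in>{-int n..int n}. {A \<in> space (tuples ?d). sh k A \<in> T})"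
        using cover by (auto simp: space_tuples PiE_iff)
    qed (intro sets.finite_UN pre finite_atLeastAtMost_int)
    also have "\<dots> \<le> (\<Sum>k\<in>{-int n..int n}. emeasure (tuples ?d) {A \<in> space (tuples ?d). sh k A \<in> T})"
      by (rule emeasure_subadditive_finite) (use pre in auto)
    also have "\<dots> = (\<Sum>k\<in>{-int n..int n}. emeasure (tuples ?d) T)"
      unfolding sh_def using emeasure_shift_tuple_vimage[OF T] by simp
    also have "\<dots> = of_nat (2 * n + 1) * emeasure (tuples ?d) T"
    proof -
      have "card {-int n..int n} = 2 * n + 1" by (simp add: nat_eq_iff)
      then show ?thesis by (simp only: sum_constant)
    qed
    also have "\<dots> \<le> of_nat (3 * n) * emeasure (tuples ?d) T"
      using n by (intro mult_right_mono of_nat_mono) auto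
    also have "\<dots> = ennreal (3 * real n) * emeasure (tuples ?d) T"
      by (metis ennreal_of_nat_eq_real_of_nat of_nat_mult of_nat_numeral)
    finally have "ennreal (u / 3 / real n) * ennreal (3 * real n) \<le> emeasure (tuples ?d) T * ennreal (3 * real n)"
      using n \<open>u > 0\<close> by (subst ennreal_mult[symmetric]) (auto simp: mult.commute)
    then show "ennreal (u / 3 / real n) \<le> emeasure (tuples ?d)
        {A \<in> {..?d} \<rightarrow>\<^sub>E {x \<in> unit_cube. x $ h 0 \<le> 1 / 2}. thin ?d (axis (h 0) 1) (1 / (4 * real n)) A}"
      using n by (subst (asm) mult.commute, subst (asm) (2) mult.commute, subst (asm) ennreal_mult_le_mult_iff) (auto simp: T_def L_def e_def s_def)
  qed
qed

lemma avoiding_measure_ge: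
  obtains c :: real where "c > 0"
    "\<And>n (N :: (real ^ 'n::finite) set). n \<ge> 4 \<Longrightarrow> finite N \<Longrightarrow> card N \<le> n \<Longrightarrow>
       ennreal (c / real n) \<le> emeasure (tuples CARD('n)) (avoiding CARD('n) unit_cube N)"
proof -
  obtain c :: real and x0 :: 'n where c: "c > 0"
    "\<And>n. n \<ge> 4 \<Longrightarrow> ennreal (c / real n) \<le>
       emeasure (tuples CARD('n)) {A \<in> {..CARD('n)} \<rightarrow>\<^sub>E {x \<in> unit_cube. x $ x0 \<le> 1 / 2}.
         thin CARD('n) (axis x0 1) (1 / (4 * real n)) A}"
    by (rule thin_tuples_measure_ge) (rule that)
  show thesis
  proof (rule that[of "c / 2"])
    fix n :: nat and N :: "(real ^ 'n) set"
    assume n: "n \<ge> 4" "finite N" "card N \<le> n"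
    have "{x \<in> unit_cube. x $ x0 \<le> 1 / 2} = (unit_cube :: (real ^ 'n) set) \<inter> {x. x $ x0 \<le> 1 / 2}"
      by auto
    also have "\<dots> \<in> sets borel"
      by (intro sets.Int unit_cube_borel borel_closed closed_Collect_le continuous_intros)
    finally have L: "{x :: real ^ 'n. x \<in> unit_cube \<and> x $ x0 \<le> 1 / 2} \<in> sets borel" .
    have "ennreal 2 * ennreal (c / 2 / real n) = ennreal (c / real n)"
      using c by (subst ennreal_mult[symmetric]) auto
    also have "\<dots> \<le> ennreal 2 * emeasure (tuples CARD('n)) (avoiding CARD('n) unit_cube N)"
    proof (rule order_trans[OF c(2)[OF n(1)]])
      have step: "x + (real j * (1 / (4 * real n))) *\<^sub>R axis x0 1 \<in> unit_cube"
        if "x \<in> unit_cube" "x $ x0 \<le> 1 / 2" "j < 2 * n" for x :: "real ^ 'n" and j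
      proof -
        define t where "t = real j * (1 / (4 * real n))"
        have "0 \<le> t" "t \<le> 1 / 2" using n that(3) by (auto simp: t_def field_simps)
        then have "x + t *\<^sub>R axis x0 1 \<in> unit_cube" using that(1,2) by (auto simp: mem_unit_cube axis_def)
        then show ?thesis by (simp only: t_def)
      qed
      show "emeasure (tuples CARD('n)) {A \<in> {..CARD('n)} \<rightarrow>\<^sub>E {x \<in> unit_cube. x $ x0 \<le> 1 / 2}.
         thin CARD('n) (axis x0 1) (1 / (4 * real n)) A}
         \<le> ennreal 2 * emeasure (tuples CARD('n)) (avoiding CARD('n) unit_cube N)"
        unfolding ennreal_numeral
        by (rule thin_le_twice_avoiding[OF n(2,3) _ _ unit_cube_borel L]) (use n step in auto)
    qed
    finally show "ennreal (c / 2 / real n) \<le> emeasure (tuples CARD('n)) (avoiding CARD('n) unit_cube N)"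
      by (subst (asm) ennreal_mult_le_mult_iff) auto
  qed (use c in auto)
qed

section \<open>A greedy hitting set\<close>
text \<open>
  By averaging over \<open>X\<close>, some point lies in at least the fraction \<open>\<delta>\<close> of the sets that are not yet
  hit.  Choosing such points greedily shrinks the number of missed sets by the factor \<open>1 - \<delta>\<close> in every
  step.
\<close>
lemma hitting_set_exists:
  fixes Q :: "'i \<Rightarrow> 'a::euclidean_space set"
  assumes "finite I" and X: "X \<in> lmeasurable" "measure lebesgue X = 1"
    and Q: "\<And>i. i \<in> I \<Longrightarrow> Q i \<in> lmeasurable" "\<And>i. i \<in> I \<Longrightarrow> Q i \<subseteq> X"
      "\<And>i. i \<in> I \<Longrightarrow> \<delta> \<le> measure lebesgue (Q i)"
    and "0 \<le> \<delta>" "\<delta> \<le> 1"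
  shows "\<exists>N. finite N \<and> card N \<le> m \<and> real (card {i \<in> I. Q i \<inter> N = {}}) \<le> (1 - \<delta>) ^ m * real (card I)"
proof (induction m)
  case 0
  show ?case using \<open>finite I\<close> by (intro exI[of _ "{}"]) simp
next
  case (Suc m)
  then obtain N where N: "finite N" "card N \<le> m"
    "real (card {i \<in> I. Q i \<inter> N = {}}) \<le> (1 - \<delta>) ^ m * real (card I)" by blast
  define G where "G = {i \<in> I. Q i \<inter> N = {}}"
  have G: "finite G" "G \<subseteq> I" using \<open>finite I\<close> by (auto simp: G_def)
  define f where "f = (\<lambda>p. card {i \<in> G. p \<in> Q i})"
  \<comment> \<open>The values of f are bounded integers, so the maximum is attained.\<close>
  have "f p \<le> card G" for p unfolding f_def using G by (intro card_mono) auto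
  then obtain p where p: "\<And>q. f q \<le> f p"
    using ex_has_greatest_nat[of "\<lambda>_. True" _ f "Suc (card G)"] by (metis le_imp_less_Suc)
  have f_eq: "real (f q) = (\<Sum>i\<in>G. indicator (Q i) q)" for q
    using G by (simp add: f_def indicator_def sum.If_cases Int_def)
  have "\<delta> * real (card G) = (\<Sum>i\<in>G. \<delta>)" by simp
  also have "\<dots> \<le> (\<Sum>i\<in>G. measure lebesgue (Q i))"
    using G Q(3) by (intro sum_mono) auto
  also have "\<dots> = (\<Sum>i\<in>G. integral\<^sup>L lebesgue (indicator (Q i)))"
    using G Q(1) by (intro sum.cong) auto
  also have "\<dots> = integral\<^sup>L lebesgue (\<lambda>q. \<Sum>i\<in>G. indicator (Q i) q)"
    using G Q(1) by (intro Bochner_Integration.integral_sum[symmetric]) (auto simp flip: lmeasurable_iff_integrable)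
  also have "\<dots> \<le> integral\<^sup>L lebesgue (\<lambda>q. real (f p) * indicator X q)"
  proof (rule integral_mono)
    show "integrable lebesgue (\<lambda>q. \<Sum>i\<in>G. indicator (Q i) q :: real)"
      using G Q(1) by (intro Bochner_Integration.integrable_sum) (auto simp flip: lmeasurable_iff_integrable)
    show "integrable lebesgue (\<lambda>q. real (f p) * indicator X q)"
      using X(1) by (auto simp flip: lmeasurable_iff_integrable)
    fix q
    show "(\<Sum>i\<in>G. indicator (Q i) q) \<le> real (f p) * indicator X q"
    proof (cases "q \<in> X")
      case True
      then show ?thesis using p[of q] by (simp flip: f_eq)
    next
      case False
      then have "(\<Sum>i\<in>G. indicator (Q i) q :: real) = 0"
        using G Q(2) by (intro sum.neutral) (auto simp: indicator_def)
      then show ?thesis using False by simp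
    qed
  qed
  also have "\<dots> = real (f p)" using X by simp
  finally have fp: "\<delta> * real (card G) \<le> real (f p)" .
  have "{i \<in> I. Q i \<inter> insert p N = {}} = G - {i \<in> G. p \<in> Q i}"
    by (auto simp: G_def)
  then have "real (card {i \<in> I. Q i \<inter> insert p N = {}}) = real (card G) - real (f p)"
    using G \<open>f p \<le> card G\<close> by (simp add: f_def card_Diff_subset of_nat_diff)
  also have "\<dots> \<le> (1 - \<delta>) * real (card G)" using fp by (simp add: algebra_simps)
  also have "\<dots> \<le> (1 - \<delta>) * ((1 - \<delta>) ^ m * real (card I))"
    using N(3) \<open>\<delta> \<le> 1\<close> by (intro mult_left_mono) (auto simp: G_def)
  finally have "real (card {i \<in> I. Q i \<inter> insert p N = {}}) \<le> (1 - \<delta>) ^ Suc m * real (card I)"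
    by (simp add: mult.assoc)
  moreover have "card (insert p N) \<le> Suc m" using N by (simp add: card_insert_if)
  ultimately show ?case using N(1) by (intro exI[of _ "insert p N"]) auto
qed

section \<open>The core of a convex set\<close>
lemma bounded_unit_cube: "bounded unit_cube"
  by (simp add: unit_cube_def)

text \<open>
  A line in direction \<open>v\<close> meets \<open>K\<close> in an interval and leaves it only once.  Hence the translates of the
  set of exit points by multiples of \<open>v\<close> are disjoint, and \<open>m\<close> of them fit into a cube of side
  length \<open>3\<close>.
\<close>
lemma measure_exit_set_le:
  fixes K :: "(real ^ 'n) set" and v :: "real ^ 'n"
  assumes K: "convex K" "K \<subseteq> unit_cube" and "m > 0" and v: "\<And>i. \<bar>v $ i\<bar> \<le> 1 / real m"
  shows "measure lebesgue {x \<in> K. x + v \<notin> K} \<le> 3 ^ CARD('n) / real m"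
    and "{x \<in> K. x + v \<notin> K} \<in> lmeasurable"
proof -
  define D where "D = {x \<in> K. x + v \<notin> K}"
  have Km: "K \<in> lmeasurable"
    using K bounded_subset[OF bounded_unit_cube] by (intro measurable_convex) auto
  have "D = K - (+) (- v) ` K"
    by (force simp: D_def image_iff algebra_simps)
  also have "\<dots> \<in> lmeasurable"
    by (intro fmeasurable_Diff[OF Km] fmeasurableD measurable_translation[OF Km])
  finally have Dm: "D \<in> lmeasurable" .
  then show "{x \<in> K. x + v \<notin> K} \<in> lmeasurable" by (simp add: D_def)
  define E where "E = (\<lambda>j::nat. (+) (real j *\<^sub>R v) ` D)"
  have Em: "E j \<in> lmeasurable" "measure lebesgue (E j) = measure lebesgue D" for j
    unfolding E_def using Dm by (auto simp: measure_translation intro: measurable_translation)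
  have no_clash: "x + real j *\<^sub>R v \<noteq> y + real k *\<^sub>R v" if "x \<in> D" "y \<in> D" "j < k" for x y j k
  proof
    assume eq: "x + real j *\<^sub>R v = y + real k *\<^sub>R v"
    \<comment> \<open>y and x = y + l v both lie in K with l at least 1, so y + v lies between them.\<close>
    define l where "l = real (k - j)"
    have l: "l \<ge> 1" using that(3) by (simp add: l_def)
    have x: "x = y + l *\<^sub>R v"
      using eq that(3) by (simp add: l_def of_nat_diff algebra_simps)
    have "(1 - 1 / l) *\<^sub>R y + (1 / l) *\<^sub>R x \<in> K"
      using that(1,2) l K(1) by (intro convexD) (auto simp: D_def field_simps)
    moreover have "(1 - 1 / l) *\<^sub>R y + (1 / l) *\<^sub>R x = y + v"
      using l by (simp add: x algebra_simps)
    ultimately show False using that(2) by (simp add: D_def)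
  qed
  have disj: "pairwise (\<lambda>i j. disjnt (E i) (E j)) {..<m}"
  proof (rule pairwiseI)
    fix i j :: nat assume "i \<noteq> j"
    then consider "i < j" | "j < i" by linarith
    then show "disjnt (E i) (E j)"
      using no_clash by cases (auto simp: disjnt_def E_def add.commute, metis+)
  qed
  have "E j \<subseteq> cbox (\<chi> i. - 1) (\<chi> i. 2)" if "j < m" for j
  proof
    fix z assume "z \<in> E j"
    then obtain x where x: "x \<in> D" "z = x + real j *\<^sub>R v" by (auto simp: E_def add.commute)
    have "\<bar>real j * v $ i\<bar> \<le> 1" for i
    proof -
      have "\<bar>real j * v $ i\<bar> \<le> real m * (1 / real m)"
        unfolding abs_mult using that v[of i] by (intro mult_mono) auto
      then show ?thesis using \<open>m > 0\<close> by simp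
    qed
    moreover have "0 \<le> x $ i" "x $ i \<le> 1" for i
      using x(1) K(2) by (auto simp: D_def mem_unit_cube)
    ultimately show "z \<in> cbox (\<chi> i. - 1) (\<chi> i. 2)"
      unfolding mem_box_cart x(2) by (auto simp: abs_le_iff) (smt (verit))+
  qed
  then have sub: "(\<Union>j<m. E j) \<subseteq> cbox (\<chi> i. - 1) (\<chi> i. 2)" by auto
  have "real m * measure lebesgue D = (\<Sum>j<m. measure lebesgue (E j))" by (simp add: Em)
  also have "\<dots> = measure lebesgue (\<Union>j<m. E j)"
    using Em disj by (intro measure_UNION'[symmetric]) auto
  also have "\<dots> \<le> measure lebesgue (cbox (\<chi> i. - 1) (\<chi> i. 2) :: (real ^ 'n) set)"
    using sub Em by (intro measure_mono_fmeasurable) auto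
  also have "\<dots> = 3 ^ CARD('n)"
  proof -
    have "cbox (\<chi> i. - 1) (\<chi> i. 2) \<noteq> ({} :: (real ^ 'n) set)" by (simp add: interval_ne_empty_cart)
    then show ?thesis by (simp add: content_cbox_cart)
  qed
  finally show "measure lebesgue {x \<in> K. x + v \<notin> K} \<le> 3 ^ CARD('n) / real m"
    using \<open>m > 0\<close> by (simp add: D_def field_simps)
qed

text \<open>
  The points from which a step of length \<open>1 / m\<close> along any axis stays in \<open>K\<close>.  For convex \<open>K\<close>, these
  finitely many directions already leave room for every small perturbation.
\<close>
definition core :: "nat \<Rightarrow> (real ^ 'n) set \<Rightarrow> (real ^ 'n) set" where
  "core m K = {x \<in> K. \<forall>i. x + axis i (1 / real m) \<in> K \<and> x + axis i (- 1 / real m) \<in> K}"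

lemma core_subset: "core m K \<subseteq> K"
  by (auto simp: core_def)

lemma convex_core:
  assumes "convex K" shows "convex (core m K)"
proof -
  have *: "convex {x. x + v \<in> K}" for v
  proof -
    have "{x. x + v \<in> K} = (+) (- v) ` K" by (force simp: image_iff algebra_simps)
    then show ?thesis using assms by (simp add: convex_translation)
  qed
  have "core m K = K \<inter> (\<Inter>i. {x. x + axis i (1 / real m) \<in> K} \<inter> {x. x + axis i (- 1 / real m) \<in> K})"
    by (auto simp: core_def)
  also have "convex \<dots>" using assms * by (intro convex_Int convex_INT) auto
  finally show ?thesis .
qed

text \<open>
  Only points that leave \<open>K\<close> in one of the \<open>2 * d\<close> axis directions are lost.
\<close>
lemma measure_core_ge:
  fixes K :: "(real ^ 'n) set"
  assumes K: "convex K" "K \<subseteq> unit_cube" and "m > 0"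
  shows "measure lebesgue K - 2 * real CARD('n) * 3 ^ CARD('n) / real m \<le> measure lebesgue (core m K)"
proof -
  define V where "V = range (\<lambda>i::'n. axis i (1 / real m)) \<union> range (\<lambda>i::'n. axis i (- 1 / real m))"
  have V: "finite V" by (simp add: V_def)
  have "card V \<le> CARD('n) + CARD('n)"
    unfolding V_def by (intro order_trans[OF card_Un_le] add_mono card_image_le) auto
  then have cV: "real (card V) \<le> 2 * real CARD('n)" by linarith
  have Vi: "\<bar>v $ i\<bar> \<le> 1 / real m" if "v \<in> V" for v i
    using that \<open>m > 0\<close> by (auto simp: V_def axis_def)
  have Km: "K \<in> lmeasurable" "core m K \<in> lmeasurable"
    using K convex_core[OF K(1)] bounded_subset[OF bounded_unit_cube] core_subset[of m K]
    by (meson measurable_convex order_trans)+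
  have "K \<subseteq> core m K \<union> (\<Union>v\<in>V. {x \<in> K. x + v \<notin> K})"
    by (auto simp: core_def V_def)
  moreover have Um: "(\<Union>v\<in>V. {x \<in> K. x + v \<notin> K}) \<in> lmeasurable"
    using V measure_exit_set_le(2)[OF K \<open>m > 0\<close> Vi] by (intro fmeasurable.finite_UN[OF V]) auto
  ultimately have "measure lebesgue K \<le> measure lebesgue (core m K \<union> (\<Union>v\<in>V. {x \<in> K. x + v \<notin> K}))"
    using Km by (intro measure_mono_fmeasurable) auto
  also have "\<dots> \<le> measure lebesgue (core m K) + measure lebesgue (\<Union>v\<in>V. {x \<in> K. x + v \<notin> K})"
    using Km Um by (intro measure_Un_le) auto
  also have "measure lebesgue (\<Union>v\<in>V. {x \<in> K. x + v \<notin> K}) \<le> (\<Sum>v\<in>V. measure lebesgue {x \<in> K. x + v \<notin> K})"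
    using V measure_exit_set_le(2)[OF K \<open>m > 0\<close> Vi] by (intro measure_UNION_le) auto
  also have "\<dots> \<le> (\<Sum>v\<in>V. 3 ^ CARD('n) / real m)"
    using measure_exit_set_le(1)[OF K \<open>m > 0\<close> Vi] by (intro sum_mono) auto
  also have "\<dots> \<le> 2 * real CARD('n) * (3 ^ CARD('n) / real m)"
    unfolding sum_constant using cV by (intro mult_right_mono) auto
  finally show ?thesis by simp
qed

text \<open>
  The point \<open>x + u\<close> is the average of the \<open>d\<close> points \<open>x + d * u\<^sub>i * e\<^sub>i\<close>, each of which lies on a segment
  between two points of \<open>K\<close> that the definition of the core provides.
\<close>
lemma core_thicken:
  fixes K :: "(real ^ 'n) set"
  assumes "convex K" "x \<in> core m K" "m > 0" and u: "\<And>i. \<bar>u $ i\<bar> \<le> 1 / (real CARD('n) * real m)"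
  shows "x + u \<in> K"
proof -
  let ?d = "real CARD('n)"
  have "x + axis i (?d * u $ i) \<in> K" for i
  proof -
    define t where "t = (1 + ?d * real m * u $ i) / 2"
    have "\<bar>?d * real m * u $ i\<bar> \<le> 1"
      using u[of i] \<open>m > 0\<close> by (simp add: abs_mult field_simps)
    then have t: "0 \<le> t" "t \<le> 1" by (auto simp: t_def abs_le_iff)
    have "t *\<^sub>R (x + axis i (1 / real m)) + (1 - t) *\<^sub>R (x + axis i (- 1 / real m)) \<in> K"
      using t assms(1,2) by (intro convexD) (auto simp: core_def)
    also have "t *\<^sub>R (x + axis i (1 / real m)) + (1 - t) *\<^sub>R (x + axis i (- 1 / real m)) = x + axis i (?d * u $ i)"
      using \<open>m > 0\<close> by (simp add: vec_eq_iff axis_def t_def field_simps)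
    finally show ?thesis .
  qed
  then have "(\<Sum>i\<in>UNIV. (1 / ?d) *\<^sub>R (x + axis i (?d * u $ i))) \<in> K"
    using assms(1) by (intro convex_sum) auto
  also have "(\<Sum>i\<in>UNIV. (1 / ?d) *\<^sub>R (x + axis i (?d * u $ i)))
      = (\<Sum>i\<in>(UNIV :: 'n set). (1 / ?d) *\<^sub>R x) + (\<Sum>i\<in>UNIV. axis i (u $ i))"
    by (subst sum.distrib[symmetric], rule sum.cong) (auto simp: vec_eq_iff axis_def field_simps)
  also have "(\<Sum>i\<in>UNIV. axis i (u $ i)) = u"
    by (simp add: vec_eq_iff axis_def)
  also have "(\<Sum>i\<in>(UNIV :: 'n set). (1 / ?d) *\<^sub>R x) = x"
    by (simp only: sum_constant_scaleR) simp
  finally show ?thesis .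
qed

section \<open>Large parallelepipeds in convex sets\<close>
text \<open>
  A tuple of \<open>d + 1\<close> points is indexed by the option type of the coordinate type, with the base point at
  \<open>None\<close>.  The columns of this matrix are the edges from the base point.
\<close>
definition edges :: "('n option \<Rightarrow> real ^ 'n) \<Rightarrow> real ^ 'n ^ 'n" where
  "edges b = (\<chi> i j. b (Some j) $ i - b None $ i)"

lemma edges_mult: "b None + edges b *v t = b None + (\<Sum>j\<in>UNIV. t $ j *\<^sub>R (b (Some j) - b None))"
  by (simp add: vec_eq_iff edges_def matrix_vector_mult_def mult.commute)

definition parallelepiped :: "real \<Rightarrow> real \<Rightarrow> ('n option \<Rightarrow> real ^ 'n) \<Rightarrow> (real ^ 'n) set" where
  "parallelepiped l u b = (\<lambda>t. b None + edges b *v t) ` cbox (\<chi> i. l) (\<chi> i. u)"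

lemma lmeasurable_parallelepiped: "parallelepiped l u b \<in> lmeasurable"
proof -
  have eq: "parallelepiped l u b = (+) (b None) ` ((*v) (edges b) ` cbox (\<chi> i. l) (\<chi> i. u))"
    by (simp add: parallelepiped_def image_image)
  show ?thesis
    unfolding eq by (intro measurable_translation measurable_linear_image_interval matrix_vector_mul_linear)
qed

text \<open>
  One parallelepiped is the image of the other under a homothety composed with a translation, so
  their volumes compare without knowing either of them.
\<close>
lemma measure_parallelepiped_rescale:
  fixes b :: "'n option \<Rightarrow> real ^ 'n"
  assumes "0 < r"
  shows "measure lebesgue (parallelepiped l (l + r * u) b) = r ^ CARD('n) * measure lebesgue (parallelepiped 0 u b)"
proof -
  let ?I = "cbox (\<chi> i. 0) (\<chi> i. u) :: (real ^ 'n) set"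
  have box: "cbox (\<chi> i. l) (\<chi> i. l + r * u) = (\<lambda>t. (\<chi> i. l) + r *\<^sub>R t) ` ?I"
  proof (intro equalityI subsetI)
    fix t :: "real ^ 'n" assume t: "t \<in> cbox (\<chi> i. l) (\<chi> i. l + r * u)"
    have "t = (\<chi> i. l) + r *\<^sub>R ((1 / r) *\<^sub>R (t - (\<chi> i. l)))" using assms by simp
    moreover have "(1 / r) *\<^sub>R (t - (\<chi> i. l)) \<in> ?I"
      using t assms by (auto simp: mem_box_cart field_simps)
    ultimately show "t \<in> (\<lambda>t. (\<chi> i. l) + r *\<^sub>R t) ` ?I" by blast
  qed (use assms in \<open>auto simp: mem_box_cart intro!: mult_left_mono\<close>)
  define c where "c = b None - r *\<^sub>R b None + edges b *v (\<chi> i. l)"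
  have "parallelepiped l (l + r * u) b = (\<lambda>z. r *\<^sub>R z + c) ` parallelepiped 0 u b"
    unfolding parallelepiped_def box image_image
    by (intro image_cong refl)
      (simp add: c_def matrix_vector_right_distrib matrix_vector_mult_scaleR algebra_simps)
  then show ?thesis using assms by (simp add: measure_lebesgue_affine)
qed

lemma det_bounded:
  fixes A :: "real ^ 'n ^ 'n"
  assumes "\<And>i j. \<bar>A $ i $ j\<bar> \<le> B"
  shows "\<bar>det A\<bar> \<le> real (card {p. p permutes (UNIV :: 'n set)}) * B ^ CARD('n)"
proof -
  have "\<bar>det A\<bar> \<le> (\<Sum>p | p permutes (UNIV :: 'n set). B ^ CARD('n))"
    unfolding det_def
  proof (rule order_trans[OF sum_abs sum_mono])
    fix p
    have "\<bar>of_int (sign p) * (\<Prod>i\<in>UNIV. A $ i $ p i)\<bar> = (\<Prod>i\<in>UNIV. \<bar>A $ i $ p i\<bar>)"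
      by (simp add: abs_mult abs_prod sign_def)
    also have "\<dots> \<le> (\<Prod>i\<in>(UNIV :: 'n set). B)" using assms by (intro prod_mono) auto
    finally show "\<bar>of_int (sign p) * (\<Prod>i\<in>UNIV. A $ i $ p i)\<bar> \<le> B ^ CARD('n)" by simp
  qed
  then show ?thesis by simp
qed

lemma sum_option:
  fixes f :: "'n::finite option \<Rightarrow> 'b::comm_monoid_add"
  shows "(\<Sum>x\<in>UNIV. f x) = f None + (\<Sum>j\<in>UNIV. f (Some j))"
  by (simp add: UNIV_option_conv sum.reindex)

text \<open>
  Coefficients of size at most \<open>1 / d\<close> add up to at most \<open>1\<close>, so this parallelepiped lies in the
  simplex spanned by the vertices.
\<close>
lemma parallelepiped_weights:
  fixes b :: "'n option \<Rightarrow> real ^ 'n"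
  assumes "z \<in> parallelepiped 0 (1 / real CARD('n)) b"
  obtains c where "\<And>x. 0 \<le> c x" "(\<Sum>x\<in>UNIV. c x) = 1" "z = (\<Sum>x\<in>UNIV. c x *\<^sub>R b x)"
proof -
  obtain t where "t \<in> cbox (\<chi> i. 0) (\<chi> i. 1 / real CARD('n))" and z: "z = b None + edges b *v t"
    using assms by (auto simp: parallelepiped_def)
  then have t: "0 \<le> t $ j" "t $ j \<le> 1 / real CARD('n)" for j
    by (auto simp: mem_box_cart)
  define c where "c = (\<lambda>x. case x of None \<Rightarrow> 1 - (\<Sum>j\<in>UNIV. t $ j) | Some j \<Rightarrow> t $ j)"
  show thesis
  proof (rule that[of c])
    have "(\<Sum>j\<in>UNIV. t $ j) \<le> (\<Sum>j\<in>(UNIV :: 'n set). 1 / real CARD('n))"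
      using t(2) by (intro sum_mono) auto
    then have "(\<Sum>j\<in>UNIV. t $ j) \<le> 1" by simp
    then show "0 \<le> c x" for x using t(1) by (auto simp: c_def split: option.split)
    show "(\<Sum>x\<in>UNIV. c x) = 1" by (simp add: sum_option c_def)
    show "z = (\<Sum>x\<in>UNIV. c x *\<^sub>R b x)"
      unfolding z edges_mult
      by (simp add: sum_option c_def algebra_simps sum_subtractf scaleR_sum_left)
  qed
qed

lemma parallelepiped_subset_convex:
  fixes b :: "'n option \<Rightarrow> real ^ 'n"
  assumes "convex C" "\<And>x. b x \<in> C"
  shows "parallelepiped 0 (1 / real CARD('n)) b \<subseteq> C"
proof
  fix z assume "z \<in> parallelepiped 0 (1 / real CARD('n)) b"
  then obtain c where "\<And>x. 0 \<le> c x" "(\<Sum>x\<in>UNIV. c x) = 1" "z = (\<Sum>x\<in>UNIV. c x *\<^sub>R b x)"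
    by (rule parallelepiped_weights) (rule that)
  then show "z \<in> C" using assms by (auto intro!: convex_sum)
qed

text \<open>
  Choose \<open>d + 1\<close> points of \<open>C\<close> whose edge determinant is more than half the supremum.  Replacing
  a vertex other than the base point by an arbitrary point \<open>x\<close> of \<open>C\<close> multiplies the determinant by a coordinate of \<open>x\<close> with respect to
  the edges, by Cramer's rule.  So all these coordinates are at most \<open>2\<close> in absolute value, and \<open>C\<close> lies in a
  parallelepiped whose edges are \<open>4 * d\<close> times as long as those of the one inscribed in the simplex.
\<close>
lemma convex_contains_large_parallelepiped:
  fixes C :: "(real ^ 'n) set"
  assumes "convex C" "bounded C" "measure lebesgue C > 0"
  obtains b where "\<And>x. b x \<in> C"
    "measure lebesgue C \<le> (4 * real CARD('n)) ^ CARD('n) * measure lebesgue (parallelepiped 0 (1 / real CARD('n)) b)"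
proof -
  let ?d = "CARD('n)"
  define X where "X = {\<bar>det (edges b)\<bar> | b. range b \<subseteq> C}"
  have Cm: "C \<in> lmeasurable" using assms by (intro measurable_convex)
  obtain B where B: "\<And>x. x \<in> C \<Longrightarrow> norm x \<le> B"
    using assms(2) by (auto simp: bounded_iff)
  have bdd: "bdd_above X"
  proof (rule bdd_aboveI)
    fix y assume "y \<in> X"
    then obtain b where b: "range b \<subseteq> C" "y = \<bar>det (edges b)\<bar>" by (auto simp: X_def)
    have "\<bar>edges b $ i $ j\<bar> \<le> 2 * B" for i j
    proof -
      have "\<bar>b x $ i\<bar> \<le> B" for x
        by (rule order_trans[OF component_le_norm_cart B]) (use b(1) in auto)
      from this[of "Some j"] this[of None] show ?thesis by (auto simp: edges_def abs_le_iff)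
    qed
    from det_bounded[OF this] show "y \<le> real (card {p. p permutes (UNIV :: 'n set)}) * (2 * B) ^ ?d"
      by (simp add: b(2))
  qed
  \<comment> \<open>The supremum is positive: C contains a small ball, and hence a small right-angled corner.\<close>
  have "\<not> negligible C" using assms(3) by (auto simp: negligible_iff_measure)
  then have "interior C \<noteq> {}" using negligible_convex_interior[OF assms(1)] by simp
  then obtain x0 r where r: "r > 0" "cball x0 r \<subseteq> C" by (auto simp: mem_interior_cball)
  define b0 where "b0 = (\<lambda>x. case x of None \<Rightarrow> x0 | Some j \<Rightarrow> x0 + axis j r)"
  have "range b0 \<subseteq> C"
  proof -
    have "norm (axis j r :: real ^ 'n) = r" for j
      using r by (simp add: norm_eq_sqrt_inner inner_axis_axis)
    then show ?thesis
      using r by (auto simp: b0_def dist_norm split: option.split intro!: subsetD[OF r(2)])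
  qed
  have "edges b0 = (\<chi> i j. if i = j then r else 0)"
    by (simp add: edges_def b0_def vec_eq_iff axis_def)
  also have "det \<dots> = r ^ ?d" by (subst det_diagonal) auto
  finally have "r ^ ?d \<in> X" using \<open>range b0 \<subseteq> C\<close> r by (auto simp: X_def intro!: exI[of _ b0])
  then have "0 < Sup X" using cSup_upper[OF _ bdd, of "r ^ ?d"] r by (smt (verit) zero_less_power)
  then have "Sup X / 2 < Sup X" by simp
  then obtain y where "y \<in> X" "Sup X / 2 < y"
    using \<open>r ^ ?d \<in> X\<close> by (metis empty_iff less_cSupE)
  then obtain b where b: "range b \<subseteq> C" "Sup X < 2 * \<bar>det (edges b)\<bar>" by (auto simp: X_def)
  have nz: "det (edges b) \<noteq> 0" using b(2) \<open>0 < Sup X\<close> by auto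
  have "C \<subseteq> parallelepiped (- 2) 2 b"
  proof
    fix x assume "x \<in> C"
    obtain t where t: "edges b *v t = x - b None"
      using cramer[OF nz, of _ "x - b None"] by blast
    have "\<bar>t $ k\<bar> \<le> 2" for k
    proof -
      have "range (b(Some k := x)) \<subseteq> C" using b(1) \<open>x \<in> C\<close> by auto
      then have "\<bar>det (edges (b(Some k := x)))\<bar> \<le> Sup X"
        by (intro cSup_upper[OF _ bdd]) (unfold X_def, blast)
      also have "edges (b(Some k := x)) = (\<chi> i j. if j = k then (edges b *v t) $ i else edges b $ i $ j)"
        unfolding t by (simp add: edges_def vec_eq_iff)
      also have "det \<dots> = t $ k * det (edges b)" by (rule cramer_lemma)
      finally have "\<bar>t $ k\<bar> * \<bar>det (edges b)\<bar> < 2 * \<bar>det (edges b)\<bar>" using b(2) by (simp add: abs_mult)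
      then show ?thesis using nz by simp
    qed
    then have "t \<in> cbox (\<chi> i. - 2) (\<chi> i. 2)"
      by (auto simp: mem_box_cart abs_le_iff) (smt (verit))
    moreover have "x = b None + edges b *v t" using t by simp
    ultimately show "x \<in> parallelepiped (- 2) 2 b" by (auto simp: parallelepiped_def)
  qed
  then have "measure lebesgue C \<le> measure lebesgue (parallelepiped (- 2) 2 b)"
    using Cm lmeasurable_parallelepiped[of "-2" 2 b] by (intro measure_mono_fmeasurable) auto
  also have "\<dots> = (4 * real ?d) ^ ?d * measure lebesgue (parallelepiped 0 (1 / real ?d) b)"
    using measure_parallelepiped_rescale[of "4 * real ?d" "- 2" "1 / real ?d" b] by simp
  finally show thesis using b(1) by (intro that[of b]) auto
qed

section \<open>A small net for large convex sets\<close>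
text \<open>
  Points with the same weights in the two parallelepipeds differ by no more than the vertices do, and
  the core of \<open>K\<close> leaves that much room.
\<close>
lemma parallelepiped_perturb:
  fixes b b' :: "'n option \<Rightarrow> real ^ 'n"
  assumes "convex K" "m > 0" and b: "\<And>x. b x \<in> core m K"
    and close: "\<And>x i. \<bar>b' x $ i - b x $ i\<bar> \<le> 1 / (real CARD('n) * real m)"
  shows "parallelepiped 0 (1 / real CARD('n)) b' \<subseteq> K"
proof
  fix z assume "z \<in> parallelepiped 0 (1 / real CARD('n)) b'"
  then obtain c where c: "\<And>x. 0 \<le> c x" "(\<Sum>x\<in>UNIV. c x) = 1" "z = (\<Sum>x\<in>UNIV. c x *\<^sub>R b' x)"
    by (rule parallelepiped_weights) (rule that)
  have "(\<Sum>x\<in>UNIV. c x *\<^sub>R b x) \<in> core m K"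
    using c b convex_core[OF assms(1)] by (intro convex_sum) auto
  moreover have "\<bar>(z - (\<Sum>x\<in>UNIV. c x *\<^sub>R b x)) $ i\<bar> \<le> 1 / (real CARD('n) * real m)" for i
  proof -
    have "\<bar>(z - (\<Sum>x\<in>UNIV. c x *\<^sub>R b x)) $ i\<bar> = \<bar>\<Sum>x\<in>UNIV. c x * (b' x $ i - b x $ i)\<bar>"
      by (simp add: c(3) sum_subtractf right_diff_distrib)
    also have "\<dots> \<le> (\<Sum>x\<in>UNIV. c x * (1 / (real CARD('n) * real m)))"
    proof (rule order_trans[OF sum_abs sum_mono])
      fix x
      show "\<bar>c x * (b' x $ i - b x $ i)\<bar> \<le> c x * (1 / (real CARD('n) * real m))"
        unfolding abs_mult abs_of_nonneg[OF c(1)] by (rule mult_left_mono[OF close c(1)])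
    qed
    also have "\<dots> = 1 / (real CARD('n) * real m)"
      unfolding sum_distrib_right[symmetric] c(2) by simp
    finally show ?thesis .
  qed
  ultimately have "(\<Sum>x\<in>UNIV. c x *\<^sub>R b x) + (z - (\<Sum>x\<in>UNIV. c x *\<^sub>R b x)) \<in> K"
    using core_thicken[OF assms(1) _ assms(2)] by blast
  then show "z \<in> K" by simp
qed

text \<open>
  It suffices to hit finitely many parallelepipeds.  The vertices of parallelepipeds of
  volume at least \<open>\<delta>\<close> are rounded to a grid of mesh \<open>1 / (d * m)\<close>, and one representative is kept for each of
  the polynomially many rounded tuples.  The core of a large convex set \<open>K\<close> contains a large
  parallelepiped, and the representative of its class still lies in \<open>K\<close> by \<open>parallelepiped_perturb\<close>.
  The greedy choice then needs only a number of points that is logarithmic in the number of classes.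
\<close>
lemma convex_net_of_size:
  fixes \<delta> :: real
  assumes m: "m > 0" "4 * real CARD('n) * 3 ^ CARD('n) / real m \<le> \<epsilon>"
    and \<delta>: "\<delta> = \<epsilon> / (2 * (4 * real CARD('n)) ^ CARD('n))" "\<delta> \<le> 1" "0 < \<epsilon>"
    and n: "(1 - \<delta>) ^ n * (real (CARD('n) * m) + 1) ^ CARD('n option \<times> 'n) < 1"
  shows "\<exists>N :: (real ^ 'n::finite) set. finite N \<and> card N \<le> n \<and>
    (\<forall>K. convex K \<and> K \<subseteq> unit_cube \<and> \<epsilon> < measure lebesgue K \<longrightarrow> K \<inter> N \<noteq> {})"
proof -
  let ?d = "CARD('n)"
  let ?P = "parallelepiped 0 (1 / real ?d) :: ('n option \<Rightarrow> real ^ 'n) \<Rightarrow> (real ^ 'n) set"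
  define M where "M = ?d * m"
  have "M > 0" using m by (simp add: M_def)
  define \<phi> :: "('n option \<Rightarrow> real ^ 'n) \<Rightarrow> 'n option \<times> 'n \<Rightarrow> int" where
    "\<phi> = (\<lambda>b (x, i). \<lfloor>real M * b x $ i\<rfloor>)"
  define Good where "Good = {b. range b \<subseteq> unit_cube \<and> \<delta> \<le> measure lebesgue (?P b)}"
  define R where "R = (UNIV \<rightarrow>\<^sub>E {0..int M} :: ('n option \<times> 'n \<Rightarrow> int) set)"
  have "\<phi> ` Good \<subseteq> R"
  proof -
    have "0 \<le> \<lfloor>real M * b x $ i\<rfloor> \<and> \<lfloor>real M * b x $ i\<rfloor> \<le> int M" if "b \<in> Good" for b x i
    proof -
      have "b x \<in> unit_cube" using that by (auto simp: Good_def)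
      then have "0 \<le> b x $ i" "b x $ i \<le> 1" by (auto simp: mem_unit_cube)
      then have "0 \<le> real M * b x $ i" "real M * b x $ i \<le> real M * 1"
        by (auto intro: mult_left_le)
      then show ?thesis by (simp add: floor_le_iff)
    qed
    then show ?thesis by (auto simp: R_def \<phi>_def PiE_iff)
  qed
  moreover have R: "finite R" "card R = (M + 1) ^ CARD('n option \<times> 'n)"
    unfolding R_def by (auto intro!: finite_PiE simp: card_PiE nat_add_distrib)
  ultimately have I: "finite (\<phi> ` Good)" "card (\<phi> ` Good) \<le> (M + 1) ^ CARD('n option \<times> 'n)"
    using finite_subset card_mono by metis+
  define rep where "rep = (\<lambda>r. SOME b. b \<in> Good \<and> \<phi> b = r)"
  have rep: "rep r \<in> Good" "\<phi> (rep r) = r" if "r \<in> \<phi> ` Good" for r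
  proof -
    have "\<exists>b. b \<in> Good \<and> \<phi> b = r" using that by auto
    from someI_ex[OF this] show "rep r \<in> Good" "\<phi> (rep r) = r" by (auto simp: rep_def)
  qed
  have "\<exists>N. finite N \<and> card N \<le> n \<and> real (card {r \<in> \<phi> ` Good. ?P (rep r) \<inter> N = {}})
      \<le> (1 - \<delta>) ^ n * real (card (\<phi> ` Good))"
  proof (rule hitting_set_exists[OF I(1)])
    fix r assume "r \<in> \<phi> ` Good"
    from rep(1)[OF this] have "range (rep r) \<subseteq> unit_cube" and large: "\<delta> \<le> measure lebesgue (?P (rep r))"
      by (auto simp: Good_def)
    then show "?P (rep r) \<subseteq> unit_cube"
      by (intro parallelepiped_subset_convex convex_unit_cube) auto
    show "\<delta> \<le> measure lebesgue (?P (rep r))" by (rule large)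
    show "?P (rep r) \<in> lmeasurable" by (rule lmeasurable_parallelepiped)
  next
    show "0 \<le> \<delta>" "\<delta> \<le> 1" using \<delta> by simp_all
  qed simp_all
  then obtain N where N: "finite N" "card N \<le> n"
    "real (card {r \<in> \<phi> ` Good. ?P (rep r) \<inter> N = {}}) \<le> (1 - \<delta>) ^ n * real (card (\<phi> ` Good))"
    by blast
  have "(1 - \<delta>) ^ n * real (card (\<phi> ` Good)) \<le> (1 - \<delta>) ^ n * real ((M + 1) ^ CARD('n option \<times> 'n))"
    using I(2) \<delta>(2) by (intro mult_left_mono of_nat_mono) auto
  also have "\<dots> = (1 - \<delta>) ^ n * (real M + 1) ^ CARD('n option \<times> 'n)"
    by (simp add: add.commute)
  also have "\<dots> < 1" using n by (simp only: M_def)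
  finally have "real (card {r \<in> \<phi> ` Good. ?P (rep r) \<inter> N = {}}) < 1" using N(3) by linarith
  then have "card {r \<in> \<phi> ` Good. ?P (rep r) \<inter> N = {}} = 0" by simp
  then have hit: "?P (rep r) \<inter> N \<noteq> {}" if "r \<in> \<phi> ` Good" for r
    using I(1) that by (auto simp: card_eq_0_iff)
  show ?thesis
  proof (intro exI[of _ N] conjI allI impI; (elim conjE)?)
    fix K :: "(real ^ 'n) set" assume K: "convex K" "K \<subseteq> unit_cube" "\<epsilon> < measure lebesgue K"
    have "2 * real ?d * 3 ^ ?d / real m \<le> \<epsilon> / 2" using m(2) by simp
    then have core: "\<epsilon> / 2 \<le> measure lebesgue (core m K)"
      using measure_core_ge[OF K(1,2) m(1)] K(3) by linarith
    have "bounded (core m K)"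
      using bounded_subset[OF bounded_unit_cube] core_subset[of m K] K(2) by blast
    then obtain b where b: "\<And>x. b x \<in> core m K"
      "measure lebesgue (core m K) \<le> (4 * real ?d) ^ ?d * measure lebesgue (?P b)"
      using convex_contains_large_parallelepiped[OF convex_core[OF K(1)], of m] core \<delta>(3) by force
    have "\<delta> \<le> measure lebesgue (?P b)"
      using core b(2) unfolding \<delta>(1) by (simp add: field_simps)
    moreover have "range b \<subseteq> unit_cube" using b(1) core_subset[of m K] K(2) by blast
    ultimately have "b \<in> Good" by (simp add: Good_def)
    define b' where "b' = rep (\<phi> b)"
    have b': "\<phi> b' = \<phi> b" using rep(2)[of "\<phi> b"] \<open>b \<in> Good\<close> by (simp add: b'_def)
    have "?P b' \<subseteq> K"
    proof (rule parallelepiped_perturb[OF K(1) m(1) b(1)])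
      fix x i
      have "\<lfloor>real M * b' x $ i\<rfloor> = \<lfloor>real M * b x $ i\<rfloor>"
        using fun_cong[OF b', of "(x, i)"] by (simp add: \<phi>_def)
      then have "\<bar>real M * b' x $ i - real M * b x $ i\<bar> \<le> 1" by linarith
      then have "real M * \<bar>b' x $ i - b x $ i\<bar> \<le> 1"
        by (simp add: abs_mult right_diff_distrib[symmetric])
      then show "\<bar>b' x $ i - b x $ i\<bar> \<le> 1 / (real ?d * real m)"
        using \<open>M > 0\<close> by (simp add: M_def field_simps)
    qed
    then show "K \<inter> N \<noteq> {}" using hit[of "\<phi> b"] \<open>b \<in> Good\<close> by (auto simp: b'_def)
  qed (use N in auto)
qed

text \<open>
  With \<open>\<delta>\<close> proportional to \<open>\<epsilon>\<close> and \<open>(E / \<epsilon>)\<^sup>D\<close> classes, the greedy choice stops once the number of points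
  exceeds \<open>D * ln (E / \<epsilon>) / \<delta>\<close>.  For \<open>\<epsilon> \<le> 1 / 2\<close> the constant \<open>E\<close> can be absorbed, as \<open>log 2 (1 / \<epsilon>) \<ge> 1\<close>.
\<close>
lemma convex_net_exists:
  obtains C :: real where "C > 0"
    "\<And>\<epsilon>. 0 < \<epsilon> \<Longrightarrow> \<epsilon> \<le> 1 / 2 \<Longrightarrow> \<exists>N :: (real ^ 'n::finite) set. finite N \<and>
       real (card N) \<le> C * (log 2 (1 / \<epsilon>) / \<epsilon>) \<and>
       (\<forall>K. convex K \<and> K \<subseteq> unit_cube \<and> \<epsilon> < measure lebesgue K \<longrightarrow> K \<inter> N \<noteq> {})"
proof -
  let ?d = "CARD('n)" and ?D = "CARD('n option \<times> 'n)"
  define a where "a = 2 * (4 * real ?d) ^ ?d"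
  have "1 \<le> real ?d" by (simp add: Suc_le_eq)
  then have "1 \<le> (4 * real ?d) ^ ?d" by (intro one_le_power) linarith
  then have a: "1 \<le> a" by (simp add: a_def)
  define B where "B = 4 * real ?d * 3 ^ ?d"
  have "B > 0" by (simp add: B_def)
  define E where "E = real ?d * B + real ?d + 1"
  have E: "1 \<le> E" using \<open>B > 0\<close> by (simp add: E_def)
  define C where "C = real ?D * a * (ln E + 1) + 1"
  show thesis
  proof (rule that[of C])
    have "0 \<le> real ?D * a * (ln E + 1)" using a E by (intro mult_nonneg_nonneg add_nonneg_nonneg) auto
    then show "C > 0" by (simp add: C_def)
    fix \<epsilon> :: real assume \<epsilon>: "0 < \<epsilon>" "\<epsilon> \<le> 1 / 2"
    define L where "L = log 2 (1 / \<epsilon>)"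
    have "2 \<le> 1 / \<epsilon>" using \<epsilon> by (simp add: field_simps)
    then have "log 2 2 \<le> log 2 (1 / \<epsilon>)" using \<epsilon> by (subst log_le_cancel_iff) auto
    then have L: "1 \<le> L" by (simp add: L_def)
    define \<delta> where "\<delta> = \<epsilon> / a"
    have \<delta>: "0 < \<delta>" "\<delta> \<le> 1" using \<epsilon> a by (auto simp: \<delta>_def field_simps)
    define m where "m = nat \<lceil>B / \<epsilon>\<rceil>"
    have "0 < B / \<epsilon>" using \<epsilon> \<open>B > 0\<close> by simp
    then have m: "m > 0" "B / \<epsilon> \<le> real m" "real m \<le> B / \<epsilon> + 1"
      unfolding m_def by linarith+
    define lnE where "lnE = ln (E / \<epsilon>)"
    define n where "n = nat \<lfloor>real ?D * lnE / \<delta>\<rfloor> + 1"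
    have lnE: "exp lnE = E / \<epsilon>" using E \<epsilon> by (simp add: lnE_def)
    have "1 \<le> E / \<epsilon>" using E \<epsilon> by (simp add: field_simps)
    then have "0 \<le> lnE" by (simp add: lnE_def)
    then have "0 \<le> real ?D * lnE / \<delta>" using \<delta> by simp
    then have n: "real ?D * lnE / \<delta> < real n" "real n \<le> real ?D * lnE / \<delta> + 1"
      unfolding n_def by linarith+
    have "real (?d * m) + 1 \<le> real ?d * (B / \<epsilon> + 1) + 1"
      using m(3) by (simp add: mult_left_mono)
    also have "\<dots> \<le> real ?d * (B / \<epsilon> + 1 / \<epsilon>) + 1 / \<epsilon>"
      using \<open>2 \<le> 1 / \<epsilon>\<close> by (intro add_mono mult_left_mono) auto
    also have "\<dots> = E / \<epsilon>" by (simp add: E_def algebra_simps add_divide_distrib)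
    finally have grid: "real (?d * m) + 1 \<le> E / \<epsilon>" .
    have "(1 - \<delta>) ^ n * (real (?d * m) + 1) ^ ?D \<le> exp (- \<delta>) ^ n * exp lnE ^ ?D"
      using \<delta> grid lnE exp_ge_add_one_self[of "- \<delta>"] by (intro mult_mono power_mono) auto
    also have "\<dots> = exp (real ?D * lnE - \<delta> * real n)"
      by (simp add: exp_of_nat_mult[symmetric] exp_diff exp_minus field_simps mult.commute)
    also have "\<dots> < 1" using n(1) \<delta> by (simp add: field_simps)
    finally have "(1 - \<delta>) ^ n * (real (?d * m) + 1) ^ ?D < 1" .
    moreover have "4 * real ?d * 3 ^ ?d / real m \<le> \<epsilon>"
      using m(1,2) \<epsilon> by (simp add: B_def field_simps)
    ultimately obtain N :: "(real ^ 'n) set" where N: "finite N" "card N \<le> n"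
      "\<forall>K. convex K \<and> K \<subseteq> unit_cube \<and> \<epsilon> < measure lebesgue K \<longrightarrow> K \<inter> N \<noteq> {}"
      using convex_net_of_size[of m \<epsilon> \<delta> n] m(1) \<delta>(2) \<epsilon>(1) unfolding \<delta>_def a_def by blast
    have "lnE = ln E + ln 2 * L"
      using E \<epsilon> by (simp add: lnE_def L_def ln_div log_def)
    also have "\<dots> \<le> ln E * L + 1 * L"
      using E L ln_2_less_1 by (intro add_mono mult_right_mono) (auto simp: mult_le_cancel_left1)
    finally have "lnE \<le> (ln E + 1) * L" by (simp add: algebra_simps)
    then have "real ?D * lnE / \<delta> \<le> real ?D * ((ln E + 1) * L) / \<delta>"
      using \<delta> by (intro divide_right_mono mult_left_mono) auto
    also have "\<dots> = real ?D * a * (ln E + 1) * (L / \<epsilon>)" by (simp add: \<delta>_def)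
    finally have "real n \<le> real ?D * a * (ln E + 1) * (L / \<epsilon>) + 1" using n(2) by linarith
    moreover have "1 \<le> L / \<epsilon>" using L \<epsilon> by (simp add: field_simps)
    moreover have "C * (L / \<epsilon>) = real ?D * a * (ln E + 1) * (L / \<epsilon>) + L / \<epsilon>"
      unfolding C_def by (simp only: distrib_right[of _ 1] mult_1)
    ultimately have "real n \<le> C * (L / \<epsilon>)" by linarith
    then show "\<exists>N :: (real ^ 'n) set. finite N \<and> real (card N) \<le> C * (log 2 (1 / \<epsilon>) / \<epsilon>) \<and>
       (\<forall>K. convex K \<and> K \<subseteq> unit_cube \<and> \<epsilon> < measure lebesgue K \<longrightarrow> K \<inter> N \<noteq> {})"
      using N by (intro exI[of _ N]) (auto simp: L_def)
  qed
qed

section \<open>The punctured cube\<close>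
lemma punctured_cube_index:
  fixes N :: "(real ^ 'n) set"
  assumes "finite N"
  shows "convexity_index_defined k (unit_cube - N)" "measure lebesgue (unit_cube - N) = 1"
    "measure (tuple_lebesgue k) (Simp k (unit_cube - N)) = measure (tuples k) (avoiding k unit_cube N)"
proof -
  have S: "Simp k (unit_cube - N) = avoiding k unit_cube N"
    by (rule Simp_Diff_eq_avoiding) simp
  have m: "avoiding k unit_cube N \<in> sets (tuples k)"
    by (rule sets_avoiding[OF assms]) simp
  have N: "N \<in> null_sets lebesgue"
    using negligible_finite[OF assms] by (simp add: negligible_iff_null_sets)
  show one: "measure lebesgue (unit_cube - N) = 1"
    using measure_Diff_null_set[OF fmeasurableD[OF lmeasurable_unit_cube] N] by simp
  have "unit_cube - N \<in> lmeasurable"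
    by (intro fmeasurable_Diff lmeasurable_unit_cube) (use N in auto)
  then show "convexity_index_defined k (unit_cube - N)"
    using one m by (simp add: convexity_index_defined_def S tuple_lebesgue_def sets_completionI_sets)
  show "measure (tuple_lebesgue k) (Simp k (unit_cube - N)) = measure (tuples k) (avoiding k unit_cube N)"
    unfolding S tuple_lebesgue_def by (rule measure_completion[OF m])
qed

lemma emeasure_avoiding_unit_cube_le:
  fixes N :: "(real ^ 'n) set"
  shows "emeasure (tuples k) (avoiding k unit_cube N) \<le> 1"
proof -
  interpret product_sigma_finite "\<lambda>i::nat. lborel :: (real ^ 'n) measure"
    by (rule product_sigma_finite_lborel)
  have cube: "emeasure lborel (unit_cube :: (real ^ 'n) set) = 1"
  proof -
    have "emeasure lborel (unit_cube :: (real ^ 'n) set) = emeasure lebesgue (unit_cube :: (real ^ 'n) set)"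
      by simp
    also have "\<dots> = ennreal (measure lebesgue (unit_cube :: (real ^ 'n) set))"
      by (rule emeasure_eq_measure2[OF lmeasurable_unit_cube])
    finally show ?thesis by (simp only: measure_unit_cube ennreal_1)
  qed
  have "emeasure (tuples k) (avoiding k unit_cube N) \<le> emeasure (tuples k) ({..k} \<rightarrow>\<^sub>E (unit_cube :: (real ^ 'n) set))"
    by (rule emeasure_mono) (auto simp: avoiding_def intro!: sets_PiM_I_finite)
  also have "\<dots> = 1"
    by (subst emeasure_PiM) (auto simp: cube)
  finally show ?thesis .
qed

lemma convexity_ratio_le:
  fixes S :: "(real ^ 'n) set"
  assumes "measure lebesgue S = 1" "0 \<le> \<epsilon>"
    and "\<And>K. convex K \<Longrightarrow> K \<subseteq> S \<Longrightarrow> measure lebesgue K \<le> \<epsilon>"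
  shows "convexity_ratio S \<le> \<epsilon>" "0 \<le> convexity_ratio S"
proof -
  show "convexity_ratio S \<le> \<epsilon>"
    unfolding convexity_ratio_def smc_def assms(1) div_by_1
    by (rule cSUP_least) (use assms in auto)
  have "measure lebesgue ({} :: (real ^ 'n) set) \<le> (SUP K\<in>{K. convex K \<and> K \<subseteq> S}. measure lebesgue K)"
    by (rule cSUP_upper) (use assms(3) in \<open>auto intro!: bdd_aboveI2[of _ _ \<epsilon>]\<close>)
  then show "0 \<le> convexity_ratio S"
    by (simp add: convexity_ratio_def smc_def assms(1))
qed

lemma set_with_large_index_exists:
  obtains \<gamma> :: real where "\<gamma> > 0"
    "\<And>\<epsilon>. 0 < \<epsilon> \<Longrightarrow> \<epsilon> \<le> 1 / 2 \<Longrightarrow> \<exists>S :: (real ^ 'n::finite) set.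
       convexity_index_defined CARD('n) S \<and> 0 \<le> convexity_ratio S \<and> convexity_ratio S \<le> \<epsilon> \<and>
       \<gamma> * (\<epsilon> / log 2 (1 / \<epsilon>)) \<le> convexity_index CARD('n) S"
proof -
  obtain c :: real where c: "c > 0"
    "\<And>n (N :: (real ^ 'n) set). n \<ge> 4 \<Longrightarrow> finite N \<Longrightarrow> card N \<le> n \<Longrightarrow>
       ennreal (c / real n) \<le> emeasure (tuples CARD('n)) (avoiding CARD('n) unit_cube N)"
    by (rule avoiding_measure_ge[where 'n = 'n]) (rule that)
  obtain C :: real where C: "C > 0"
    "\<And>\<epsilon>. 0 < \<epsilon> \<Longrightarrow> \<epsilon> \<le> 1 / 2 \<Longrightarrow> \<exists>N :: (real ^ 'n::finite) set. finite N \<and>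
       real (card N) \<le> C * (log 2 (1 / \<epsilon>) / \<epsilon>) \<and>
       (\<forall>K. convex K \<and> K \<subseteq> unit_cube \<and> \<epsilon> < measure lebesgue K \<longrightarrow> K \<inter> N \<noteq> {})"
    by (rule convex_net_exists[where 'n = 'n]) (rule that)
  show thesis
  proof (rule that[of "c / (C + 4)"])
    show "c / (C + 4) > 0" using c C by simp
    fix \<epsilon> :: real assume \<epsilon>: "0 < \<epsilon>" "\<epsilon> \<le> 1 / 2"
    define L where "L = log 2 (1 / \<epsilon>)"
    have "2 \<le> 1 / \<epsilon>" using \<epsilon> by (simp add: field_simps)
    then have "log 2 2 \<le> log 2 (1 / \<epsilon>)" using \<epsilon> by (subst log_le_cancel_iff) auto
    then have L: "1 \<le> L" by (simp add: L_def)
    obtain N :: "(real ^ 'n) set" where N: "finite N" "real (card N) \<le> C * (L / \<epsilon>)"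
      "\<And>K. convex K \<Longrightarrow> K \<subseteq> unit_cube \<Longrightarrow> \<epsilon> < measure lebesgue K \<Longrightarrow> K \<inter> N \<noteq> {}"
      using C(2)[OF \<epsilon>] unfolding L_def by blast
    \<comment> \<open>The lower bound for avoiding simplices is available for n at least 4 only.\<close>
    define n where "n = card N + 4"
    have "1 \<le> L / \<epsilon>" using L \<epsilon> by (simp add: field_simps)
    then have n: "real n \<le> (C + 4) * (L / \<epsilon>)" using N(2) unfolding n_def distrib_right by linarith
    define S where "S = unit_cube - N"
    note S = punctured_cube_index[OF N(1), folded S_def]
    have "c / (C + 4) * (\<epsilon> / L) = c / ((C + 4) * (L / \<epsilon>))" by simp
    also have "\<dots> \<le> c / real n"
      using n c(1) by (intro frac_le) (auto simp: n_def)
    also have "\<dots> \<le> measure (tuples CARD('n)) (avoiding CARD('n) unit_cube N)"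
    proof -
      have "ennreal (c / real n) \<le> emeasure (tuples CARD('n)) (avoiding CARD('n) unit_cube N)"
        by (rule c(2)) (use N in \<open>auto simp: n_def\<close>)
      moreover have "emeasure (tuples CARD('n)) (avoiding CARD('n) unit_cube N) < top"
        by (rule le_less_trans[OF emeasure_avoiding_unit_cube_le]) simp
      ultimately have "enn2real (ennreal (c / real n)) \<le> measure (tuples CARD('n)) (avoiding CARD('n) unit_cube N)"
        unfolding measure_def by (rule enn2real_mono)
      then show ?thesis using c(1) by simp
    qed
    also have "\<dots> = convexity_index CARD('n) S"
      by (simp add: convexity_index_def S)
    finally have idx: "c / (C + 4) * (\<epsilon> / L) \<le> convexity_index CARD('n) S" .
    have "measure lebesgue K \<le> \<epsilon>" if "convex K" "K \<subseteq> S" for K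
      using N(3)[of K] that by (auto simp: S_def not_less[symmetric])
    from convexity_ratio_le[OF S(2) less_imp_le[OF \<epsilon>(1)] this] S(1) idx
    show "\<exists>S :: (real ^ 'n) set.
       convexity_index_defined CARD('n) S \<and> 0 \<le> convexity_ratio S \<and> convexity_ratio S \<le> \<epsilon> \<and>
       c / (C + 4) * (\<epsilon> / log 2 (1 / \<epsilon>)) \<le> convexity_index CARD('n) S"
      unfolding L_def by blast
  qed
qed

text \<open>
  The point \<open>x = 0\<close> is included for sets without convex subsets of positive measure, whose convexity
  ratio vanishes.
\<close>
lemma div_log_inverse_mono:
  fixes x y :: real
  assumes "0 \<le> x" "x \<le> y" "y < 1"
  shows "x / log 2 (1 / x) \<le> y / log 2 (1 / y)"
proof (cases "x = 0")
  case True
  have "0 \<le> y / log 2 (1 / y)"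
  proof (cases "y = 0")
    case False
    then have "0 < y" "1 \<le> 1 / y" using assms by (auto simp: field_simps)
    then have "0 \<le> log 2 (1 / y)" by (subst zero_le_log_cancel_iff) auto
    then show ?thesis using assms by simp
  qed simp
  then show ?thesis using True by simp
next
  case False
  then have x: "0 < x" using assms by simp
  then have "0 < y" "1 / y \<le> 1 / x" "1 < 1 / y" using assms by (auto simp: field_simps)
  then have "log 2 (1 / y) \<le> log 2 (1 / x)" "0 < log 2 (1 / y)"
    using x by (subst log_le_cancel_iff zero_less_log_cancel_iff; simp)+
  then show ?thesis using assms x by (intro frac_le) auto
qed

theorem theorem1p6:
  fixes \<epsilon>\<^sub>0 :: real
  assumes "CARD('n::finite) \<ge> 2" and "\<epsilon>\<^sub>0 < 1"
  shows "\<exists>\<gamma>::real. \<gamma> > 0 \<and>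
    (\<forall>\<epsilon>::real. 0 < \<epsilon> \<and> \<epsilon> \<le> \<epsilon>\<^sub>0 \<longrightarrow>
      (\<exists>S :: (real ^ 'n) set.
        convexity_index_defined CARD('n) S \<and>
        convexity_ratio S \<le> \<epsilon> \<and>
        convexity_index CARD('n) S \<ge> \<gamma> * (\<epsilon> / log 2 (1 / \<epsilon>)) \<and>
        convexity_index CARD('n) S \<ge>
          \<gamma> * (convexity_ratio S / log 2 (1 / convexity_ratio S))))"
proof -
  obtain \<gamma> :: real where \<gamma>: "\<gamma> > 0"
    "\<And>\<epsilon>. 0 < \<epsilon> \<Longrightarrow> \<epsilon> \<le> 1 / 2 \<Longrightarrow> \<exists>S :: (real ^ 'n::finite) set.
       convexity_index_defined CARD('n) S \<and> 0 \<le> convexity_ratio S \<and> convexity_ratio S \<le> \<epsilon> \<and>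
       \<gamma> * (\<epsilon> / log 2 (1 / \<epsilon>)) \<le> convexity_index CARD('n) S"
    by (rule set_with_large_index_exists[where 'n = 'n]) (rule that)
  \<comment> \<open>For \<epsilon> above 1/2 the set that belongs to 1/2 serves; the bound to be met is then at most
    a constant that depends on how far \<epsilon> stays away from 1.\<close>
  define e where "e = max \<epsilon>\<^sub>0 (1 / 2)"
  have e: "1 / 2 \<le> e" "e < 1" "\<epsilon>\<^sub>0 \<le> e" using assms(2) by (auto simp: e_def)
  then have "0 < e" by linarith
  define L where "L = log 2 (1 / e)"
  have "1 < 1 / e" "1 / e \<le> 2" using e \<open>0 < e\<close> by (auto simp: field_simps)
  have "0 < L" unfolding L_def using \<open>1 < 1 / e\<close> \<open>0 < e\<close> by (subst zero_less_log_cancel_iff) auto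
  have "L \<le> log 2 2" unfolding L_def using \<open>1 < 1 / e\<close> \<open>1 / e \<le> 2\<close> \<open>0 < e\<close> by (subst log_le_cancel_iff) auto
  with \<open>0 < L\<close> have L: "0 < L" "L \<le> 1" by simp_all
  show ?thesis
  proof (intro exI[of _ "\<gamma> * L / 2"] conjI allI impI)
    show "\<gamma> * L / 2 > 0" using \<gamma>(1) L by simp
    fix \<epsilon> :: real assume \<epsilon>: "0 < \<epsilon> \<and> \<epsilon> \<le> \<epsilon>\<^sub>0"
    define \<epsilon>' where "\<epsilon>' = min \<epsilon> (1 / 2)"
    have \<epsilon>': "0 < \<epsilon>'" "\<epsilon>' \<le> 1 / 2" "\<epsilon>' \<le> \<epsilon>" using \<epsilon> by (auto simp: \<epsilon>'_def)
    obtain S :: "(real ^ 'n) set" where S: "convexity_index_defined CARD('n) S"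
      "0 \<le> convexity_ratio S" "convexity_ratio S \<le> \<epsilon>'"
      "\<gamma> * (\<epsilon>' / log 2 (1 / \<epsilon>')) \<le> convexity_index CARD('n) S"
      using \<gamma>(2)[OF \<epsilon>'(1,2)] by blast
    have lower: "L / 2 * (\<epsilon> / log 2 (1 / \<epsilon>)) \<le> \<epsilon>' / log 2 (1 / \<epsilon>')"
    proof (cases "\<epsilon> \<le> 1 / 2")
      case True
      have "0 \<le> \<epsilon> / log 2 (1 / \<epsilon>)"
        using div_log_inverse_mono[of 0 \<epsilon>] True \<epsilon> by simp
      then have "L / 2 * (\<epsilon> / log 2 (1 / \<epsilon>)) \<le> 1 * (\<epsilon> / log 2 (1 / \<epsilon>))"
        using L by (intro mult_right_mono) auto
      moreover have "\<epsilon>' = \<epsilon>" using True by (simp add: \<epsilon>'_def)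
      ultimately show ?thesis by (simp only: mult_1)
    next
      case False
      have "\<epsilon> / log 2 (1 / \<epsilon>) \<le> e / log 2 (1 / e)"
        using \<epsilon> e by (intro div_log_inverse_mono) auto
      also have "\<dots> \<le> 1 / L" unfolding L_def[symmetric] using L e by (intro divide_right_mono) auto
      finally have "L / 2 * (\<epsilon> / log 2 (1 / \<epsilon>)) \<le> L / 2 * (1 / L)"
        using L by (intro mult_left_mono) auto
      also have "\<dots> = 1 / 2" using L by simp
      finally show ?thesis using False by (simp add: \<epsilon>'_def)
    qed
    have index: "\<gamma> * L / 2 * (\<epsilon> / log 2 (1 / \<epsilon>)) \<le> convexity_index CARD('n) S"
      using order_trans[OF mult_left_mono[OF lower less_imp_le[OF \<gamma>(1)]] S(4)] by (simp add: mult.assoc)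
    have "convexity_ratio S / log 2 (1 / convexity_ratio S) \<le> \<epsilon> / log 2 (1 / \<epsilon>)"
      using S(2,3) \<epsilon>' \<epsilon> assms(2) by (intro div_log_inverse_mono) auto
    then have "\<gamma> * L / 2 * (convexity_ratio S / log 2 (1 / convexity_ratio S)) \<le> \<gamma> * L / 2 * (\<epsilon> / log 2 (1 / \<epsilon>))"
      using \<gamma>(1) L by (intro mult_left_mono) auto
    with index S(1,3) \<epsilon>'(3) show "\<exists>S :: (real ^ 'n) set.
        convexity_index_defined CARD('n) S \<and>
        convexity_ratio S \<le> \<epsilon> \<and>
        convexity_index CARD('n) S \<ge> \<gamma> * L / 2 * (\<epsilon> / log 2 (1 / \<epsilon>)) \<and>
        convexity_index CARD('n) S \<ge>
          \<gamma> * L / 2 * (convexity_ratio S / log 2 (1 / convexity_ratio S))"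
      by (intro exI[of _ S]) auto
  qed
qed

end
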